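(* (1) Every nilpotent Lie algebra with 1-dimensional center is the reduced direct product of a Heisenberg algebra and a Lie algebra of type $(A)$. (2) Every 3-step nilpotent Lie algebra $\mathfrak k$ of type $(A)$ is the reduced semidirect product $\mathfrak k=\mathfrak k_1\,\widetilde{\rtimes}\,\mathfrak a$ of a Lie subalgebra $\mathfrak k_1$ of type $(A_+)$ and a 2-step nilpotent Lie subalgebra $\mathfrak a$ whose derived algebra $[\mathfrak a,\mathfrak a]$ is contained in the center of $\mathfrak k$ and which is compatible with a suitable grading of type $(A_+)$ of $\mathfrak k_1$.
   Context: $\mathbb K$ is an arbitrary field of characteristic different from $2$; all vector spaces and Lie algebras are finite-dimensional over $\mathbb K$; $\dotplus$ denotes direct sum of vector (sub)spaces. For a Lie algebra $\mathfrak k$: $\mathcal Z(\mathfrak k)$ is the center and $\mathcal C_2\mathfrak k=\{X\in\mathfrak k\mid[\mathfrak k,[\mathfrak k,X]]=0\}$ is the second center. "2-step nilpotent" means $[\mathfrak a,[\mathfrak a,\mathfrak a]]=0$ and "3-step nilpotent" means $[\mathfrak k,[\mathfrak k,[\mathfrak k,\mathfrak k]]]=0$ (nilpotency class at most 2, respectively 3). A Heisenberg algebra is a Lie algebra isomorphic to $\mathfrak h_{\mathcal W}=\mathbb K\times\mathcal W^*\times\mathcal W$ with bracket $[(t,\xi,w),(t',\xi',w')]=(\xi(w')-\xi'(w),0,0)$, for an arbitrary finite-dimensional vector space $\mathcal W$ ($\mathcal W=0$ allowed). Let $\mathfrak k$ be a nilpotent Lie algebra with $\dim\mathcal Z(\mathfrak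 k)=1$. It is of type $(A)$ if either $[\mathcal C_2\mathfrak k,\mathcal C_2\mathfrak k]=0$ or $\mathcal C_2\mathfrak k=\mathfrak k$. It is of type $(A_+)$ if either $\mathcal C_2\mathfrak k$ is a maximal abelian subalgebra of $\mathfrak k$ or $\mathcal C_2\mathfrak k=\mathfrak k$. A grading of type $(A_+)$ of $\mathfrak k$ is a triple $\gamma=(\mathfrak z,\mathfrak c,\mathcal V)$ of linear subspaces with $\mathfrak k=\mathfrak z\dotplus\mathfrak c\dotplus\mathcal V$, $\mathfrak z=\mathcal Z(\mathfrak k)$, $[\mathfrak c,\mathfrak c]=0$, $[\mathcal V,\mathcal V]\subseteq\mathfrak c$, and such that the Lie bracket gives rise to a duality pairing (nondegenerate bilinear map) $[\cdot,\cdot]\colon\mathfrak c\times\mathcal V\to\mathcal Z(\mathfrak k)\simeq\mathbb K$. Compatibility: if $\mathfrak k_1$ and $\mathfrak a$ are subalgebras of a Lie algebra with $[\mathfrak a,\mathfrak k_1]\subseteq\mathfrak k_1$ and $\mathfrak k_1$ has a grading $\gamma=(\mathfrak z,\mathfrak c,\mathcal V)$ of type $(A_+)$, then $\mathfrak a$ is compatible with $\gamma$ if $[\mathfrak a,\mathcal V]\subseteq\mathfrak c$ and $[\mathfrak a,\mathfrak z+\mathfrak c]=0$. Reduced products: a Lie algebra $\mathfrak g$ with $\dim\mathcal Z(\mathfrak g)=1$ and two subalgebras $\mathfrak g_1,\mathfrak g_2$ is the reduced semidirect product $\mathfrak g=\mathfrak g_1\,\widetilde{\rtimes}\,\mathfrak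 g_2$ if $[\mathfrak g_2,\mathfrak g_1]\subseteq\mathfrak g_1$, $\mathfrak g=\mathfrak g_1+\mathfrak g_2$ and $\mathcal Z(\mathfrak g)=\mathfrak g_1\cap\mathfrak g_2$. If also $[\mathfrak g_1,\mathfrak g_2]=0$, then $\mathfrak g$ is called the reduced direct product of $\mathfrak g_1$ and $\mathfrak g_2$. *)

theory Defs
  imports
    Complex_Main
    "HOL-Library.Set_Algebras"
    "HOL-Library.Product_Plus"
    "HOL-Library.Function_Algebras"
begin

text \<open>
  A finite-dimensional Lie algebra over a field is modelled on a whole type \<open>'v\<close>; the notions below
  take a carrier \<open>L\<close> as argument, so that they apply both to the ambient Lie algebra (\<open>L = UNIV\<close>) and
  to its subalgebras. Sums \<open>A + B\<close> of sets are Minkowski sums.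
\<close>

locale lie_algebra = finite_dimensional_vector_space scale Basis
  for scale :: "'k::field \<Rightarrow> 'v::ab_group_add \<Rightarrow> 'v" and Basis :: "'v set" +
  fixes bracket :: "'v \<Rightarrow> 'v \<Rightarrow> 'v"
  assumes bracket_add_left: "bracket (x + y) z = bracket x z + bracket y z"
    and bracket_add_right: "bracket x (y + z) = bracket x y + bracket x z"
    and bracket_scale_left: "bracket (scale c x) y = scale c (bracket x y)"
    and bracket_scale_right: "bracket x (scale c y) = scale c (bracket x y)"
    and bracket_alternating: "bracket x x = 0"
    and jacobi: "bracket x (bracket y z) + bracket y (bracket z x) + bracket z (bracket x y) = 0"
begin

definition subalgebra :: "'v set \<Rightarrow> bool" where
  "subalgebra L \<longleftrightarrow> subspace L \<and> (\<forall>x\<in>L. \<forall>y\<in>L. bracket x y \<in> L)"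

definition bracket_set :: "'v set \<Rightarrow> 'v set \<Rightarrow> 'v set" where
  "bracket_set A B = span {bracket x y | x y. x \<in> A \<and> y \<in> B}"

definition center :: "'v set \<Rightarrow> 'v set" where
  "center L = {x \<in> L. \<forall>y\<in>L. bracket y x = 0}"

definition second_center :: "'v set \<Rightarrow> 'v set" where
  "second_center L = {x \<in> L. \<forall>y\<in>L. \<forall>z\<in>L. bracket y (bracket z x) = 0}"

primrec lower_central :: "'v set \<Rightarrow> nat \<Rightarrow> 'v set" where
  "lower_central L 0 = L"
| "lower_central L (Suc n) = bracket_set L (lower_central L n)"

definition nilpotent :: "'v set \<Rightarrow> bool" where
  "nilpotent L \<longleftrightarrow> (\<exists>n. lower_central L n = {0})"

definition two_step_nilpotent :: "'v set \<Rightarrow> bool" where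
  "two_step_nilpotent L \<longleftrightarrow> bracket_set L (bracket_set L L) = {0}"

definition three_step_nilpotent :: "'v set \<Rightarrow> bool" where
  "three_step_nilpotent L \<longleftrightarrow> bracket_set L (bracket_set L (bracket_set L L)) = {0}"

definition nilpotent_dim1_center :: "'v set \<Rightarrow> bool" where
  "nilpotent_dim1_center L \<longleftrightarrow> subalgebra L \<and> nilpotent L \<and> dim (center L) = 1"

definition maximal_abelian :: "'v set \<Rightarrow> 'v set \<Rightarrow> bool" where
  "maximal_abelian L A \<longleftrightarrow>
     subalgebra A \<and> A \<subseteq> L \<and> bracket_set A A = {0} \<and>
     (\<forall>B. subalgebra B \<and> B \<subseteq> L \<and> bracket_set B B = {0} \<and> A \<subseteq> B \<longrightarrow> B = A)"

definition type_A :: "'v set \<Rightarrow> bool" where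
  "type_A L \<longleftrightarrow> nilpotent_dim1_center L \<and>
     (bracket_set (second_center L) (second_center L) = {0} \<or> second_center L = L)"

definition type_A_plus :: "'v set \<Rightarrow> bool" where
  "type_A_plus L \<longleftrightarrow> nilpotent_dim1_center L \<and>
     (maximal_abelian L (second_center L) \<or> second_center L = L)"

definition direct_sum3 :: "'v set \<Rightarrow> 'v set \<Rightarrow> 'v set \<Rightarrow> 'v set \<Rightarrow> bool" where
  "direct_sum3 L A B C \<longleftrightarrow> subspace A \<and> subspace B \<and> subspace C \<and> L = A + B + C \<and>
     (\<forall>a\<in>A. \<forall>b\<in>B. \<forall>c\<in>C. a + b + c = 0 \<longrightarrow> a = 0 \<and> b = 0 \<and> c = 0)"

definition grading_A_plus :: "'v set \<Rightarrow> 'v set \<times> 'v set \<times> 'v set \<Rightarrow> bool" where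
  "grading_A_plus L \<gamma> \<longleftrightarrow> (case \<gamma> of (z, c, V) \<Rightarrow>
     nilpotent_dim1_center L \<and>
     direct_sum3 L z c V \<and>
     z = center L \<and>
     bracket_set c c = {0} \<and>
     bracket_set V V \<subseteq> c \<and>
     bracket_set c V \<subseteq> center L \<and>
     (\<forall>x\<in>c. (\<forall>v\<in>V. bracket x v = 0) \<longrightarrow> x = 0) \<and>
     (\<forall>v\<in>V. (\<forall>x\<in>c. bracket x v = 0) \<longrightarrow> v = 0))"

definition compatible :: "'v set \<Rightarrow> 'v set \<Rightarrow> 'v set \<times> 'v set \<times> 'v set \<Rightarrow> bool" where
  "compatible \<aa> L \<gamma> \<longleftrightarrow> (case \<gamma> of (z, c, V) \<Rightarrow>
     subalgebra \<aa> \<and> subalgebra L \<and> bracket_set \<aa> L \<subseteq> L \<and> grading_A_plus L \<gamma> \<and>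
     bracket_set \<aa> V \<subseteq> c \<and> bracket_set \<aa> (z + c) = {0})"

definition reduced_semidirect :: "'v set \<Rightarrow> 'v set \<Rightarrow> 'v set \<Rightarrow> bool" where
  "reduced_semidirect G G1 G2 \<longleftrightarrow>
     subalgebra G \<and> dim (center G) = 1 \<and> subalgebra G1 \<and> subalgebra G2 \<and>
     bracket_set G2 G1 \<subseteq> G1 \<and> G = G1 + G2 \<and> center G = G1 \<inter> G2"

definition reduced_direct :: "'v set \<Rightarrow> 'v set \<Rightarrow> 'v set \<Rightarrow> bool" where
  "reduced_direct G G1 G2 \<longleftrightarrow> reduced_semidirect G G1 G2 \<and> bracket_set G1 G2 = {0}"

text \<open>
  The model \<open>\<K> \<times> W\<^sup>* \<times> W\<close> for a linear subspace \<open>W\<close>. Functionals on \<open>W\<close> are extended by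
  \<open>0\<close> outside \<open>W\<close>, so that equal functionals on \<open>W\<close>
  are equal functions.
\<close>

definition dual_of :: "'v set \<Rightarrow> ('v \<Rightarrow> 'k) set" where
  "dual_of W = {\<xi>. (\<forall>x\<in>W. \<forall>y\<in>W. \<xi> (x + y) = \<xi> x + \<xi> y) \<and>
                   (\<forall>a. \<forall>x\<in>W. \<xi> (scale a x) = a * \<xi> x) \<and>
                   (\<forall>x. x \<notin> W \<longrightarrow> \<xi> x = 0)}"

definition heisenberg_carrier :: "'v set \<Rightarrow> ('k \<times> ('v \<Rightarrow> 'k) \<times> 'v) set" where
  "heisenberg_carrier W = UNIV \<times> dual_of W \<times> W"

definition heisenberg_scale ::
  "'k \<Rightarrow> 'k \<times> ('v \<Rightarrow> 'k) \<times> 'v \<Rightarrow> 'k \<times> ('v \<Rightarrow> 'k) \<times> 'v" where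
  "heisenberg_scale a = (\<lambda>(t, \<xi>, w). (a * t, \<lambda>x. a * \<xi> x, scale a w))"

definition heisenberg_bracket ::
  "'k \<times> ('v \<Rightarrow> 'k) \<times> 'v \<Rightarrow> 'k \<times> ('v \<Rightarrow> 'k) \<times> 'v \<Rightarrow> 'k \<times> ('v \<Rightarrow> 'k) \<times> 'v" where
  "heisenberg_bracket = (\<lambda>(t, \<xi>, w) (t', \<xi>', w'). (\<xi> w' - \<xi>' w, 0, 0))"

text \<open>
  It suffices to let \<open>W\<close> range over the subspaces of the ambient space: an algebra isomorphic to
  \<open>\<K> \<times> W\<^sup>* \<times> W\<close> has dimension \<open>2 dim W + 1\<close>, so any such \<open>W\<close> is isomorphic to one of them.
\<close>

definition heisenberg :: "'v set \<Rightarrow> bool" where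
  "heisenberg L \<longleftrightarrow> subalgebra L \<and>
     (\<exists>W f. subspace W \<and> bij_betw f L (heisenberg_carrier W) \<and>
        (\<forall>x\<in>L. \<forall>y\<in>L. f (x + y) = f x + f y) \<and>
        (\<forall>a. \<forall>x\<in>L. f (scale a x) = heisenberg_scale a (f x)) \<and>
        (\<forall>x\<in>L. \<forall>y\<in>L. f (bracket x y) = heisenberg_bracket (f x) (f y)))"

end

end

(*
  Fix a linear functional \<zeta> with \<zeta> e = 1 on the center Z = span {e}; then \<zeta> [x, y] is an alternating
  form, and on the second center C it determines the bracket.

  (1) A complement H0 of the radical of this form on C spans together with Z a Heisenberg algebra:
  a maximal isotropic subspace of H0 has an isotropic complement because the characteristic is
  not 2. Nondegeneracy on H0 shows that the centralizer of H0 supplements H0.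

  (2) If C is everything, take Z as the first factor. Otherwise let D be the centralizer of the abelian
  ideal C and X = C \<inter> ker \<zeta>. A complement V of D is dual to X and can be corrected by elements
  of X so that [V, V] \<subseteq> X; then K1 = Z + X + V is graded, and A consists of the elements x of D with
  [x, V] \<subseteq> X. The second center of K1 is Z + X + {v \<in> V. [v, V] = 0}, so for K1 to be of
  type (A+) the complement V must be chosen such that [v, V] = 0 holds for all v or only for v = 0.
*)
theory Submission
  imports Defs
begin

text \<open>The delicate point of (2) is the choice of V. Modulo Z the bracket is an alternating map
  with values in the vector space C / Z, and for such a map a subspace without radical may fail to
  have an orthogonal complement, unlike for a scalar form. Moreover [D, V] need not lie in Z, so the
  map does not descend to the quotient by D, and moving V along D can change its radical. This is
  the freedom that makes the dichotomy attainable. Moving V along X, in contrast, changes brackets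
  only by elements of Z, because X lies in C. So the dichotomy is arranged first, and the correction
  to [V, V] \<subseteq> X preserves it.

  Three-step nilpotency says that all brackets lie in C. Hence a triple bracket [[x, y], p] lies in
  Z and depends on [x, y] only modulo Z, which makes it a test for brackets modulo Z. As D
  centralizes C, the Jacobi identity also gives [D, D] \<subseteq> Z, and this is why A has central
  derived algebra.

  In both parts the characteristic enters through \<open>isotropic_complement\<close>.\<close>

section \<open>Subspaces and alternating forms\<close>

context finite_dimensional_vector_space
begin

lemma dim_less_dim:
  assumes "subspace S" "subspace T" "S \<subseteq> T" "x \<in> T" "x \<notin> S"
  shows "dim S < dim T"
proof (rule dim_psubset)
  show "span S \<subset> span T"
    unfolding span_eq_iff[THEN iffD2, OF assms(1)] span_eq_iff[THEN iffD2, OF assms(2)]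
    using assms by auto
qed

lemma subspace_set_plus:
  assumes "subspace S" "subspace T"
  shows "subspace (S + T)"
proof -
  have "S + T = {x + y | x y. x \<in> S \<and> y \<in> T}"
    by (auto simp: set_plus_def)
  then show ?thesis
    using subspace_sums[OF assms] by simp
qed

text \<open>The measured set \<open>f U\<close> is kept apart from \<open>U\<close> so that
  \<open>dim (U + D)\<close> can be maximised over subspaces \<open>U\<close>.\<close>

lemma ex_maximal_dim:
  assumes "P U0"
  obtains U where "P U" "\<And>U'. P U' \<Longrightarrow> dim (f U') \<le> dim (f U)"
proof -
  have "\<forall>U. P U \<longrightarrow> dim (f U) < Suc dimension"
    using dim_subset_UNIV by (simp add: le_imp_less_Suc)
  from ex_has_greatest_nat[of P U0, OF assms this] obtain U
    where "P U" "\<forall>U'. P U' \<longrightarrow> dim (f U') \<le> dim (f U)"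
    by blast
  with that show thesis
    by blast
qed

lemma span_insert_subspace:
  assumes "subspace W"
  shows "span (insert x W) = {w + scale a x | w a. w \<in> W}"
proof -
  have "x - scale k x' \<in> W \<Longrightarrow> \<exists>w a. x = w + scale a x' \<and> w \<in> W" for x k x'
    by (metis diff_add_cancel)
  moreover have "w \<in> W \<Longrightarrow> \<exists>k. w + scale a x - scale k x \<in> W" for w a
    by (rule exI[of _ a]) simp
  ultimately show ?thesis
    unfolding span_insert span_eq_iff[THEN iffD2, OF assms] by auto
qed

text \<open>Among the subspaces of \<open>T\<close> that meet \<open>S\<close> trivially take one of
  maximal dimension: a vector of \<open>T\<close> outside \<open>S + W\<close> could be adjoined to
  it.\<close>

lemma subspace_complement:
  assumes S: "subspace S"
  assumes T: "subspace T"
  assumes "S \<subseteq> T"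
  obtains W where "subspace W" "W \<subseteq> T" "S \<inter> W = {0}" "S + W = T"
proof -
  define P where "P W \<longleftrightarrow> subspace W \<and> W \<subseteq> T \<and> S \<inter> W = {0}" for W
  have "P {0}"
    unfolding P_def using S T by (auto simp: subspace_0)
  then obtain W where "P W" and max: "\<And>W'. P W' \<Longrightarrow> dim W' \<le> dim W"
    using ex_maximal_dim[where f = "\<lambda>W. W"] by metis
  then have W: "subspace W" "W \<subseteq> T" "S \<inter> W = {0}"
    by (auto simp: P_def)
  have "T \<subseteq> S + W"
  proof
    fix x assume x: "x \<in> T"
    show "x \<in> S + W"
    proof (rule ccontr)
      assume nx: "x \<notin> S + W"
      let ?W' = "span (insert x W)"
      have "S \<inter> ?W' \<subseteq> {0}"
      proof
        fix s assume "s \<in> S \<inter> ?W'"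
        then obtain w a where s: "s \<in> S" "w \<in> W" "s = w + scale a x"
          using W by (auto simp: span_insert_subspace)
        have "a = 0"
        proof (rule ccontr)
          assume "a \<noteq> 0"
          then have "x = scale (1/a) s + scale (1/a) (- w)"
            using s by (simp add: scale_right_distrib)
          moreover have "scale (1/a) s \<in> S" "scale (1/a) (- w) \<in> W"
            using s S W by (auto intro!: subspace_scale subspace_neg)
          ultimately show False
            using nx by (metis set_plus_intro)
        qed
        then show "s \<in> {0}"
          using s W by auto
      qed
      moreover have "?W' \<subseteq> T"
        using x W T by (intro span_minimal) auto
      ultimately have "P ?W'"
        using S by (auto simp: P_def subspace_0 span_zero)
      moreover have "x \<notin> W"
        using nx S set_plus_intro[of 0 S x W] by (auto simp: subspace_0)
      then have "dim W < dim ?W'"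
        using W by (intro dim_less_dim[of _ _ x]) (auto simp: span_base)
      ultimately show False
        using max by fastforce
    qed
  qed
  moreover have "S + W \<subseteq> T"
    using assms W by (auto elim!: set_plus_elim intro!: subspace_add)
  ultimately show ?thesis
    using that W by blast
qed

text \<open>The functional is the coordinate of \<open>e\<close> in a basis that extends
  \<open>{e}\<close>.\<close>

lemma ex_dual_functional:
  assumes "e \<noteq> 0"
  obtains f where "\<And>x y. f (x + y) = f x + f y" "\<And>a x. f (scale a x) = a * f x" "f e = 1"
proof
  have i: "independent {e}"
    using assms by (simp add: independent_insert)
  let ?f = "\<lambda>x. representation (extend_basis {e}) x e"
  show "?f (x + y) = ?f x + ?f y" for x y
    using i by (simp add: representation_add independent_extend_basis)
  show "?f (scale a x) = a * ?f x" for a x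
    using i by (simp add: representation_scale independent_extend_basis)
  show "?f e = 1"
    using i extend_basis_superset[OF i]
    by (simp add: representation_basis independent_extend_basis)
qed

end

section \<open>Alternating forms: representing functionals and isotropic complements\<close>

locale alternating_form = finite_dimensional_vector_space scale Basis
  for scale :: "'k::field \<Rightarrow> 'v::ab_group_add \<Rightarrow> 'v" and Basis :: "'v set" +
  fixes \<omega> :: "'v \<Rightarrow> 'v \<Rightarrow> 'k"
  assumes form_add_left: "\<omega> (x + y) z = \<omega> x z + \<omega> y z"
    and form_scale_left: "\<omega> (scale a x) y = a * \<omega> x y"
    and form_add_right: "\<omega> x (y + z) = \<omega> x y + \<omega> x z"
    and form_scale_right: "\<omega> x (scale a y) = a * \<omega> x y"
    and form_self: "\<omega> x x = 0"
begin

lemma form_zero [simp]: "\<omega> 0 x = 0" "\<omega> x 0 = 0"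
  using form_scale_left[of 0 0 x] form_scale_right[of x 0 0] by auto

lemma form_minus [simp]: "\<omega> (- x) y = - \<omega> x y" "\<omega> x (- y) = - \<omega> x y"
  using form_add_left[of x "- x" y] form_add_right[of x y "- y"]
  by (auto simp: eq_neg_iff_add_eq_0 add.commute)

lemma form_diff: "\<omega> (x - y) z = \<omega> x z - \<omega> y z" "\<omega> x (y - z) = \<omega> x y - \<omega> x z"
  using form_add_left[of x "- y" z] form_add_right[of x y "- z"] by auto

lemma form_skew: "\<omega> y x = - \<omega> x y"
proof -
  have "\<omega> x y + \<omega> y x = 0"
    using form_self[of "x + y"] unfolding form_add_left form_add_right
    by (simp add: form_self add.commute)
  then show ?thesis
    by (simp add: eq_neg_iff_add_eq_0 add.commute)
qed

lemma form_sum_left: "\<omega> (\<Sum>i\<in>I. f i) y = (\<Sum>i\<in>I. \<omega> (f i) y)"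
  by (induction I rule: infinite_finite_induct) (auto simp: form_add_left)

lemma form_sum_right: "\<omega> x (\<Sum>i\<in>I. f i) = (\<Sum>i\<in>I. \<omega> x (f i))"
  by (induction I rule: infinite_finite_induct) (auto simp: form_add_right)

lemmas form_linear = form_add_left form_add_right form_scale_left form_scale_right form_diff

text \<open>To correct the value at a new vector \<open>b\<close> without disturbing the values on
  \<open>B\<close>, one needs an element of \<open>X\<close> that vanishes on \<open>B\<close> but
  not at \<open>b\<close>. Nondegeneracy provides it.\<close>

lemma represent_on_independent:
  assumes X: "subspace X"
    and "finite B" "independent B"
    and "\<And>v. v \<in> span B \<Longrightarrow> (\<And>x. x \<in> X \<Longrightarrow> \<omega> x v = 0) \<Longrightarrow> v = 0"
  shows "\<exists>x\<in>X. \<forall>b\<in>B. \<omega> x b = g b"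
  using assms(2-)
proof (induction B arbitrary: g rule: finite_induct)
  case empty
  then show ?case
    using X subspace_0 by auto
next
  case (insert b B)
  have indB: "independent B" and bB: "b \<notin> span B"
    using insert.prems(1) insert.hyps by (auto simp: independent_insert)
  have ndB: "v = 0" if "v \<in> span B" "\<And>x. x \<in> X \<Longrightarrow> \<omega> x v = 0" for v
    using insert.prems(2)[of v] that span_mono[of B "insert b B"] by auto
  have IH: "\<exists>x\<in>X. \<forall>b\<in>B. \<omega> x b = g b" for g
    using insert.IH[OF indB] ndB by blast
  have "\<exists>x0\<in>X. (\<forall>b'\<in>B. \<omega> x0 b' = 0) \<and> \<omega> x0 b \<noteq> 0"
  proof (rule ccontr)
    assume contra: "\<not> ?thesis"
    have "\<forall>b'\<in>B. \<exists>x\<in>X. \<forall>b''\<in>B. \<omega> x b'' = (if b'' = b' then 1 else 0)"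
      by (intro ballI IH)
    then obtain d where d: "\<And>b'. b' \<in> B \<Longrightarrow> d b' \<in> X"
      "\<And>b' b''. b' \<in> B \<Longrightarrow> b'' \<in> B \<Longrightarrow> \<omega> (d b') b'' = (if b'' = b' then 1 else 0)"
      by metis
    \<comment> \<open>Without such an element, \<open>b\<close> would act on \<open>X\<close>
      exactly as \<open>?w\<close> does: subtracting from \<open>x\<close> its components along the
      dual family \<open>d\<close> gives a vector that kills \<open>B\<close>, hence
      \<open>b\<close>. So \<open>b - ?w\<close> is orthogonal to \<open>X\<close>, and
      \<open>b\<close> would lie in the span of \<open>B\<close>.\<close>
    let ?w = "\<Sum>b'\<in>B. scale (\<omega> (d b') b) b'"
    have "\<omega> x (b - ?w) = 0" if x: "x \<in> X" for x
    proof -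
      let ?y = "x - (\<Sum>b'\<in>B. scale (\<omega> x b') (d b'))"
      have "?y \<in> X"
        using x X d by (intro subspace_diff subspace_sum subspace_scale) auto
      moreover have "\<omega> ?y b'' = 0" if "b'' \<in> B" for b''
      proof -
        have "(\<Sum>b'\<in>B. \<omega> x b' * \<omega> (d b') b'') = (\<Sum>b'\<in>B. if b'' = b' then \<omega> x b' else 0)"
          using that d by (intro sum.cong) auto
        then show ?thesis
          using that insert.hyps by (simp add: form_linear form_sum_left)
      qed
      ultimately have "\<omega> ?y b = 0"
        using contra by blast
      then show ?thesis
        by (simp add: form_linear form_sum_left form_sum_right mult.commute)
    qed
    moreover have w: "?w \<in> span B"
      by (intro span_sum span_scale span_base)
    then have "b - ?w \<in> span (insert b B)"
      by (intro span_diff) (auto intro: span_base subsetD[OF span_mono[of B "insert b B"]])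
    ultimately have "b = ?w"
      using insert.prems(2)[of "b - ?w"] by auto
    then show False
      using w bB by auto
  qed
  then obtain x0 where x0: "x0 \<in> X" "\<And>b'. b' \<in> B \<Longrightarrow> \<omega> x0 b' = 0" "\<omega> x0 b \<noteq> 0"
    by blast
  obtain x1 where x1: "x1 \<in> X" "\<And>b'. b' \<in> B \<Longrightarrow> \<omega> x1 b' = g b'"
    using IH by blast
  let ?x = "x1 + scale ((g b - \<omega> x1 b) / \<omega> x0 b) x0"
  have "?x \<in> X"
    using X x0 x1 by (intro subspace_add subspace_scale)
  moreover have "\<forall>b'\<in>insert b B. \<omega> ?x b' = g b'"
    using x0 x1 by (auto simp: form_linear)
  ultimately show ?case
    by blast
qed

text \<open>In finite dimension, injectivity of V \<rightarrow> X* gives surjectivity of X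
  \<rightarrow> V*. This supplies the correcting vectors in both parts.\<close>

lemma represent_functional:
  assumes X: "subspace X" and V: "subspace V"
    and nondeg: "\<And>v. v \<in> V \<Longrightarrow> (\<And>x. x \<in> X \<Longrightarrow> \<omega> x v = 0) \<Longrightarrow> v = 0"
    and add: "\<And>v w. v \<in> V \<Longrightarrow> w \<in> V \<Longrightarrow> g (v + w) = g v + g w"
    and scale: "\<And>a v. v \<in> V \<Longrightarrow> g (scale a v) = a * g v"
  obtains x where "x \<in> X" "\<And>v. v \<in> V \<Longrightarrow> \<omega> x v = g v"
proof -
  obtain B where B: "B \<subseteq> V" "independent B" "V \<subseteq> span B"
    using maximal_independent_subset by blast
  have spB: "span B = V"
    using B V by (simp add: span_minimal subset_antisym)
  obtain x where x: "x \<in> X" "\<forall>b\<in>B. \<omega> x b = g b"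
    using represent_on_independent[OF X finiteI_independent[OF B(2)] B(2), of g] nondeg spB by blast
  have "v \<in> V \<and> \<omega> x v = g v" if "v \<in> V" for v
  proof -
    have "v \<in> span B"
      using that spB by simp
    then show ?thesis
    proof (induction rule: span_induct_alt)
      case base
      show ?case
        using V scale[of 0 0] by (simp add: subspace_0)
    next
      case (step c b v)
      then show ?case
        using x B V by (auto simp: form_linear add scale subspace_add subspace_scale)
    qed
  qed
  then show ?thesis
    using that x by blast
qed

text \<open>
  Replacing \<open>v \<in> V\<close> by \<open>v + x\<close> with \<open>x \<in> X\<close> representing \<open>- 1/2 \<omega> v\<close> on \<open>V\<close> makes \<open>V\<close> isotropic.
\<close>

lemma isotropic_complement:
  assumes two: "(2::'k) \<noteq> 0"
    and X: "subspace X" and V: "subspace V"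
    and iso: "\<And>x y. x \<in> X \<Longrightarrow> y \<in> X \<Longrightarrow> \<omega> x y = 0"
    and nondegV: "\<And>v. v \<in> V \<Longrightarrow> (\<And>x. x \<in> X \<Longrightarrow> \<omega> x v = 0) \<Longrightarrow> v = 0"
    and nondegX: "\<And>x. x \<in> X \<Longrightarrow> (\<And>v. v \<in> V \<Longrightarrow> \<omega> x v = 0) \<Longrightarrow> x = 0"
  obtains W where "subspace W"
    "\<And>v w. v \<in> W \<Longrightarrow> w \<in> W \<Longrightarrow> \<omega> v w = 0"
    "\<And>w. w \<in> W \<Longrightarrow> \<exists>v\<in>V. w - v \<in> X"
    "\<And>v. v \<in> V \<Longrightarrow> \<exists>w\<in>W. w - v \<in> X"
    "X \<inter> W = {0}"
proof
  \<comment> \<open>\<open>R v x\<close> says that \<open>x\<close> represents -1/2 \<omega> v on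
    \<open>V\<close>, cleared of the denominator. As a relation it is linear without any choice of
    \<open>x\<close>.\<close>
  define R where "R v x \<longleftrightarrow> v \<in> V \<and> x \<in> X \<and> (\<forall>w\<in>V. 2 * \<omega> x w = - \<omega> v w)" for v x
  let ?W = "{v + x | v x. R v x}"
  have R0: "R 0 0"
    using X V by (simp add: R_def subspace_0)
  show "subspace ?W"
  proof (rule subspaceI)
    show "0 \<in> ?W"
      using R0 by force
  next
    fix p q assume "p \<in> ?W" "q \<in> ?W"
    then obtain v x w y where "R v x" "R w y" and pq: "p = v + x" "q = w + y"
      by blast
    then have "R (v + w) (x + y)"
      using X V by (simp add: R_def subspace_add form_linear distrib_left)
    moreover have "p + q = (v + w) + (x + y)"
      using pq by (simp add: algebra_simps)
    ultimately show "p + q \<in> ?W"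
      by blast
  next
    fix a p assume "p \<in> ?W"
    then obtain v x where R: "R v x" and p: "p = v + x"
      by blast
    then have "2 * (a * \<omega> x w) = - (a * \<omega> v w)" if "w \<in> V" for w
      using that by (simp add: R_def mult.left_commute[of 2])
    then have "R (scale a v) (scale a x)"
      using R X V by (simp add: R_def subspace_scale form_linear)
    then show "scale a p \<in> ?W"
      using p by (auto simp: scale_right_distrib)
  qed
  show "\<omega> p q = 0" if p: "p \<in> ?W" and q: "q \<in> ?W" for p q
  proof -
    obtain v x w y where R: "R v x" "R w y" and pq: "p = v + x" "q = w + y"
      using p q by blast
    have "\<omega> p q = \<omega> v w + \<omega> x w - \<omega> y v"
      using R iso form_skew[of v y] by (simp add: pq form_linear R_def)
    \<comment> \<open>Each of the two mixed terms contributes minus one half of \<omega> v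
      w.\<close>
    moreover have "2 * \<omega> x w = - \<omega> v w" "2 * \<omega> y v = \<omega> v w"
      using R form_skew[of w v] by (auto simp: R_def)
    ultimately have "2 * \<omega> p q = 2 * \<omega> v w - \<omega> v w - \<omega> v w"
      by (simp only: right_diff_distrib distrib_left) simp
    then have "2 * \<omega> p q = 0"
      by simp
    then show ?thesis
      using two by simp
  qed
  show "\<exists>v\<in>V. p - v \<in> X" if p: "p \<in> ?W" for p
  proof -
    obtain v x where "R v x" "p = v + x"
      using p by blast
    then show ?thesis
      by (intro bexI[of _ v]) (auto simp: R_def)
  qed
  show "\<exists>w\<in>?W. w - v \<in> X" if v: "v \<in> V" for v
  proof -
    obtain x where x: "x \<in> X" "\<And>w. w \<in> V \<Longrightarrow> \<omega> x w = - \<omega> v w / 2"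
      by (rule represent_functional[OF X V nondegV, of "\<lambda>w. - \<omega> v w / 2"])
        (auto simp: form_linear diff_divide_distrib)
    then have "R v x"
      using v two by (simp add: R_def)
    then have "v + x \<in> ?W" "v + x - v \<in> X"
      using x by auto
    then show ?thesis
      by blast
  qed
  show "X \<inter> ?W = {0}"
  proof
    show "X \<inter> ?W \<subseteq> {0}"
    proof
      fix p assume "p \<in> X \<inter> ?W"
      then obtain v x where R: "R v x" and p: "p = v + x" "p \<in> X"
        by blast
      have "v \<in> X"
        using subspace_diff[OF X p(2), of x] R p(1) by (simp add: R_def)
      then have "v = 0"
        using R iso nondegV by (auto simp: R_def)
      then have "x = 0"
        using R nondegX[of x] two by (auto simp: R_def)
      then show "p \<in> {0}"
        using p \<open>v = 0\<close> by simp
    qed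
    show "{0} \<subseteq> X \<inter> ?W"
      using R0 X by (force simp: subspace_0)
  qed
qed

end

section \<open>Lie algebras with one-dimensional center\<close>

context lie_algebra
begin

lemma bracket_zero [simp]: "bracket 0 x = 0" "bracket x 0 = 0"
  using bracket_scale_left[of 0 0 x] bracket_scale_right[of x 0 0] by auto

lemma bracket_skew: "bracket y x = - bracket x y"
proof -
  have "bracket x y + bracket y x = 0"
    using bracket_alternating[of "x + y"] unfolding bracket_add_left bracket_add_right
    by (simp add: bracket_alternating add.commute)
  then show ?thesis
    by (simp add: eq_neg_iff_add_eq_0 add.commute)
qed

lemma bracket_minus [simp]: "bracket (- x) y = - bracket x y" "bracket x (- y) = - bracket x y"
  using bracket_add_left[of x "- x" y] bracket_add_right[of x y "- y"]
  by (auto simp: eq_neg_iff_add_eq_0 add.commute)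

lemma bracket_diff:
  "bracket (x - y) z = bracket x z - bracket y z" "bracket x (y - z) = bracket x y - bracket x z"
  using bracket_add_left[of x "- y" z] bracket_add_right[of x y "- z"] by auto

lemmas bracket_linear =
  bracket_add_left bracket_add_right bracket_scale_left bracket_scale_right bracket_diff

lemma jacobi_left: "bracket (bracket x y) z = bracket x (bracket y z) - bracket y (bracket x z)"
proof -
  have "bracket z (bracket x y) = - (bracket x (bracket y z) + bracket y (bracket z x))"
    using jacobi[of x y z] by (simp only: eq_neg_iff_add_eq_0 add_ac)
  then show ?thesis
    by (simp add: bracket_skew[of "bracket x y" z] bracket_skew[of z x])
qed

lemma bracket_set_subset:
  assumes "subspace S" "\<And>x y. x \<in> A \<Longrightarrow> y \<in> B \<Longrightarrow> bracket x y \<in> S"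
  shows "bracket_set A B \<subseteq> S"
  unfolding bracket_set_def using assms by (intro span_minimal) auto

lemma bracket_in_bracket_set: "x \<in> A \<Longrightarrow> y \<in> B \<Longrightarrow> bracket x y \<in> bracket_set A B"
  unfolding bracket_set_def by (rule span_base) blast

lemma bracket_set_eq_zero_iff: "bracket_set A B = {0} \<longleftrightarrow> (\<forall>x\<in>A. \<forall>y\<in>B. bracket x y = 0)"
proof
  assume "bracket_set A B = {0}"
  then show "\<forall>x\<in>A. \<forall>y\<in>B. bracket x y = 0"
    using bracket_in_bracket_set by blast
next
  assume "\<forall>x\<in>A. \<forall>y\<in>B. bracket x y = 0"
  then have "bracket_set A B \<subseteq> {0}"
    by (intro bracket_set_subset) auto
  then show "bracket_set A B = {0}"
    by (auto simp: bracket_set_def span_zero)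
qed

lemma bracket_set_mono: "A \<subseteq> A' \<Longrightarrow> B \<subseteq> B' \<Longrightarrow> bracket_set A B \<subseteq> bracket_set A' B'"
  unfolding bracket_set_def by (intro span_mono) blast

lemma nilpotent_subspace:
  assumes "nilpotent G" "L \<subseteq> G" "subspace L"
  shows "nilpotent L"
proof -
  have mono: "lower_central L n \<subseteq> lower_central G n" for n
    by (induction n) (auto simp: assms(2) dest: subsetD[OF bracket_set_mono[OF assms(2)]])
  have zero: "0 \<in> lower_central L n" for n
    using assms(3) by (cases n) (auto simp: bracket_set_def span_zero subspace_0)
  obtain n where "lower_central G n = {0}"
    using assms(1) by (auto simp: nilpotent_def)
  then have "lower_central L n = {0}"
    using mono[of n] zero[of n] by auto
  then show ?thesis
    by (auto simp: nilpotent_def)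
qed

end

section \<open>A coordinate on the central line and the scalar form that it defines\<close>

locale lie_algebra_dim1_center = lie_algebra scale Basis bracket
  for scale :: "'k::field \<Rightarrow> 'v::ab_group_add \<Rightarrow> 'v" and Basis :: "'v set"
    and bracket :: "'v \<Rightarrow> 'v \<Rightarrow> 'v" +
  fixes e :: 'v and \<zeta> :: "'v \<Rightarrow> 'k"
  assumes center_line: "center UNIV = range (\<lambda>a. scale a e)"
    and coord_add: "\<zeta> (x + y) = \<zeta> x + \<zeta> y"
    and coord_scale: "\<zeta> (scale a x) = a * \<zeta> x"
    and coord_one: "\<zeta> e = 1"
begin

sublocale alternating_form scale Basis "\<lambda>x y. \<zeta> (bracket x y)"
proof
  have "\<zeta> 0 = 0"
    using coord_scale[of 0 0] by simp
  then show "\<zeta> (bracket x x) = 0" for x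
    by (simp add: bracket_alternating)
qed (auto simp: bracket_linear coord_add coord_scale)

abbreviation Z :: "'v set" where "Z \<equiv> center UNIV"
abbreviation C :: "'v set" where "C \<equiv> second_center UNIV"

lemma coord_zero [simp]: "\<zeta> 0 = 0"
  using coord_scale[of 0 0] by simp

lemma coord_minus [simp]: "\<zeta> (- x) = - \<zeta> x"
  using coord_add[of x "- x"] by (simp add: eq_neg_iff_add_eq_0 add.commute)

lemma coord_diff: "\<zeta> (x - y) = \<zeta> x - \<zeta> y"
  using coord_add[of x "- y"] by simp

lemma center_iff: "x \<in> Z \<longleftrightarrow> (\<forall>y. bracket y x = 0)"
  by (auto simp: center_def)

lemma subspace_center: "subspace Z"
  by (rule subspaceI) (auto simp: center_iff bracket_linear)

lemma second_center_iff: "x \<in> C \<longleftrightarrow> (\<forall>y. bracket y x \<in> Z)"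
  by (auto simp: second_center_def center_iff)

lemma bracket_center [simp]: "z \<in> Z \<Longrightarrow> bracket z y = 0" "z \<in> Z \<Longrightarrow> bracket y z = 0"
  using bracket_skew[of z y] by (auto simp: center_def)

lemma center_eq_scale: "z \<in> Z \<Longrightarrow> z = scale (\<zeta> z) e"
  by (auto simp: center_line coord_scale coord_one)

lemma center_coord_zero: "z \<in> Z \<Longrightarrow> \<zeta> z = 0 \<Longrightarrow> z = 0"
  using center_eq_scale[of z] by simp

lemma scale_in_center: "scale a e \<in> Z"
  unfolding center_line by (rule rangeI)

lemma dim_center: "dim Z = 1"
proof -
  have "e \<noteq> 0"
    using coord_one by auto
  then show ?thesis
    using dim_span[of "{e}"] by (simp add: center_line span_singleton)
qed

lemma bracket_second_center: "x \<in> C \<Longrightarrow> bracket y x \<in> Z" "x \<in> C \<Longrightarrow> bracket x y \<in> Z"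
  using bracket_skew[of x y] subspace_neg[OF subspace_center] by (auto simp: second_center_iff)

lemma subspace_second_center: "subspace C"
  by (rule subspaceI)
    (auto simp: second_center_iff bracket_linear subspace_add subspace_scale subspace_0 subspace_center)

lemma center_subset_second_center: "Z \<subseteq> C"
  by (auto simp: second_center_iff subspace_0 subspace_center)

text \<open>Since \<open>L\<close> and \<open>W\<close> are dual to each other under the form,
  \<open>L\<close> plays the role of the dual of \<open>W\<close>: the isomorphism sends z + l + w
  to (\<zeta> z, \<zeta> [l, -], w). Nondegeneracy on \<open>L\<close> makes it injective, that on
  \<open>W\<close> makes it surjective.\<close>

lemma heisenbergI:
  assumes L: "subspace L" "L \<subseteq> C" and W: "subspace W" "W \<subseteq> C"
    and isoL: "\<And>x y. x \<in> L \<Longrightarrow> y \<in> L \<Longrightarrow> bracket x y = 0"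
    and isoW: "\<And>x y. x \<in> W \<Longrightarrow> y \<in> W \<Longrightarrow> bracket x y = 0"
    and ndL: "\<And>x. x \<in> L \<Longrightarrow> (\<And>w. w \<in> W \<Longrightarrow> \<zeta> (bracket x w) = 0) \<Longrightarrow> x = 0"
    and ndW: "\<And>w. w \<in> W \<Longrightarrow> (\<And>x. x \<in> L \<Longrightarrow> \<zeta> (bracket x w) = 0) \<Longrightarrow> w = 0"
  shows "heisenberg (Z + L + W)"
proof -
  let ?H = "Z + L + W"
  \<comment> \<open>The value 0 outside \<open>W\<close> is the convention of
    \<open>dual_of\<close>.\<close>
  define F where "F l = (\<lambda>v. if v \<in> W then \<zeta> (bracket l v) else 0)" for l
  have dec: "\<exists>z l w. z \<in> Z \<and> l \<in> L \<and> w \<in> W \<and> x = z + l + w" if "x \<in> ?H" for x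
    using that by (auto elim!: set_plus_elim)
  have memH: "z + l + w \<in> ?H" if "z \<in> Z" "l \<in> L" "w \<in> W" for z l w
    using that by (intro set_plus_intro)
  have uniq: "z = z' \<and> l = l' \<and> w = w'"
    if zl: "z \<in> Z" "l \<in> L" "w \<in> W" "z' \<in> Z" "l' \<in> L" "w' \<in> W" "z + l + w = z' + l' + w'"
    for z l w z' l' w'
  proof -
    have "bracket (z + l + w) v = bracket (z' + l' + w') v" for v
      using zl by simp
    then have eq: "bracket l v + bracket w v = bracket l' v + bracket w' v" for v
      using zl(1,4) by (simp add: bracket_add_left)
    \<comment> \<open>Brackets with \<open>W\<close> see only the \<open>L\<close> component,
      brackets with \<open>L\<close> only the \<open>W\<close> component.\<close>
    have "l - l' = 0"
    proof (rule ndL)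
      show "l - l' \<in> L"
        using L zl by (simp add: subspace_diff)
      show "\<zeta> (bracket (l - l') v) = 0" if "v \<in> W" for v
        using eq[of v] isoW that zl by (simp add: bracket_linear)
    qed
    moreover have "w - w' = 0"
    proof (rule ndW)
      show "w - w' \<in> W"
        using W zl by (simp add: subspace_diff)
      show "\<zeta> (bracket v (w - w')) = 0" if "v \<in> L" for v
        using eq[of v] isoL that zl bracket_skew[of _ v] by (simp add: bracket_linear)
    qed
    ultimately show ?thesis
      using zl by simp
  qed
  obtain f where f: "\<And>z l w. z \<in> Z \<Longrightarrow> l \<in> L \<Longrightarrow> w \<in> W \<Longrightarrow> f (z + l + w) = (\<zeta> z, F l, w)"
  proof -
    obtain zf lf wf where *: "\<And>x. x \<in> ?H \<Longrightarrow> zf x \<in> Z \<and> lf x \<in> L \<and> wf x \<in> W \<and> x = zf x + lf x + wf x"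
      using dec by metis
    have "(\<lambda>x. (\<zeta> (zf x), F (lf x), wf x)) (z + l + w) = (\<zeta> z, F l, w)"
      if "z \<in> Z" "l \<in> L" "w \<in> W" for z l w
      using uniq[of z l w "zf (z + l + w)" "lf (z + l + w)" "wf (z + l + w)"]
        *[of "z + l + w"] memH that by auto
    then show thesis
      by (rule that)
  qed
  have inj: "inj_on f ?H"
  proof (rule inj_onI)
    fix x y assume x: "x \<in> ?H" and y: "y \<in> ?H" and eq: "f x = f y"
    obtain z l w where x': "z \<in> Z" "l \<in> L" "w \<in> W" "x = z + l + w"
      using dec[OF x] by blast
    obtain z' l' w' where y': "z' \<in> Z" "l' \<in> L" "w' \<in> W" "y = z' + l' + w'"
      using dec[OF y] by blast
    have *: "\<zeta> z = \<zeta> z'" "F l = F l'" "w = w'"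
      using eq f x' y' by auto
    have "l - l' = 0"
    proof (rule ndL)
      show "l - l' \<in> L"
        using L x' y' by (simp add: subspace_diff)
      show "\<zeta> (bracket (l - l') v) = 0" if "v \<in> W" for v
        using fun_cong[OF *(2), of v] that by (simp add: F_def form_diff)
    qed
    moreover have "z = z'"
      using * x' y' center_eq_scale by metis
    ultimately show "x = y"
      using * x' y' by simp
  qed
  have "f x \<in> heisenberg_carrier W" if "x \<in> ?H" for x
    using dec[OF that] f W
    by (auto simp: heisenberg_carrier_def dual_of_def F_def form_linear subspace_add subspace_scale)
  moreover have "p \<in> f ` ?H" if "p \<in> heisenberg_carrier W" for p
  proof -
    obtain t \<xi> w where p: "p = (t, \<xi>, w)" "\<xi> \<in> dual_of W" "w \<in> W"
      using \<open>p \<in> heisenberg_carrier W\<close> by (auto simp: heisenberg_carrier_def)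
    obtain l where l: "l \<in> L" "\<And>v. v \<in> W \<Longrightarrow> \<zeta> (bracket l v) = \<xi> v"
      by (rule represent_functional[OF L(1) W(1) ndW, of \<xi>]) (use p in \<open>auto simp: dual_of_def\<close>)
    have "F l = \<xi>"
      using l p by (auto simp: F_def dual_of_def)
    then have "f (scale t e + l + w) = p"
      using f p l by (simp add: scale_in_center coord_scale coord_one)
    then show ?thesis
      using memH[of "scale t e" l w] l p by (force simp: scale_in_center)
  qed
  ultimately have bij: "bij_betw f ?H (heisenberg_carrier W)"
    using inj by (auto simp: bij_betw_def)
  have subH: "subspace ?H"
    using L W subspace_center by (intro subspace_set_plus)
  have hom: "f (x + y) = f x + f y \<and> bracket x y \<in> ?H \<and> f (bracket x y) = heisenberg_bracket (f x) (f y)"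
    if x: "x \<in> ?H" and y: "y \<in> ?H" for x y
  proof -
    obtain z l w where x': "z \<in> Z" "l \<in> L" "w \<in> W" "x = z + l + w"
      using dec[OF x] by blast
    obtain z' l' w' where y': "z' \<in> Z" "l' \<in> L" "w' \<in> W" "y = z' + l' + w'"
      using dec[OF y] by blast
    have xy: "x + y = (z + z') + (l + l') + (w + w')"
      using x' y' by (simp add: algebra_simps)
    have "f (x + y) = (\<zeta> (z + z'), F (l + l'), w + w')"
      unfolding xy using x' y' L W subspace_center by (intro f) (auto simp: subspace_add)
    moreover have "F (l + l') = F l + F l'"
      by (auto simp: F_def form_linear)
    ultimately have 1: "f (x + y) = f x + f y"
      using f x' y' by (simp add: coord_add)
    have b: "bracket x y = bracket l w' - bracket l' w"
      using x' y' isoL isoW bracket_skew[of w l'] by (simp add: bracket_linear)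
    have bZ: "bracket x y \<in> Z"
      unfolding b using x' y' L bracket_second_center subspace_center
      by (intro subspace_diff) auto
    have F0: "F 0 = 0"
      by (auto simp: F_def)
    have "f (bracket x y) = (\<zeta> (bracket x y), 0, 0)"
      using f[OF bZ, of 0 0] L W F0 by (simp add: subspace_0)
    also have "\<dots> = heisenberg_bracket (f x) (f y)"
    proof -
      have "f x = (\<zeta> z, F l, w)" "f y = (\<zeta> z', F l', w')"
        using x' y' f by auto
      then show ?thesis
        using x'(3) y'(3) by (simp add: heisenberg_bracket_def b F_def coord_diff zero_fun_def)
    qed
    finally show ?thesis
      using 1 memH[OF bZ, of 0 0] L W by (simp add: subspace_0)
  qed
  have "f (scale a x) = heisenberg_scale a (f x)" if x: "x \<in> ?H" for a x
  proof -
    obtain z l w where x': "z \<in> Z" "l \<in> L" "w \<in> W" "x = z + l + w"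
      using dec[OF x] by blast
    have "F (scale a l) = (\<lambda>v. a * F l v)"
      by (auto simp: F_def form_linear)
    then show ?thesis
      using f[of "scale a z" "scale a l" "scale a w"] f[of z l w] x' L W subspace_center
      by (simp add: subspace_scale scale_right_distrib heisenberg_scale_def coord_scale)
  qed
  then show ?thesis
    unfolding heisenberg_def subalgebra_def using hom bij subH W by blast
qed

text \<open>The centralizer \<open>A\<close> of \<open>H0\<close> always meets the first alternative
  of type (A): its second center lies in the radical \<open>R\<close> of \<open>C\<close>, which is
  abelian.\<close>

lemma heisenberg_decomposition:
  assumes two: "(2::'k) \<noteq> 0" and nil: "nilpotent UNIV"
  shows "\<exists>H A. reduced_direct UNIV H A \<and> heisenberg H \<and> type_A A"
proof -
  define R where "R = {x \<in> C. \<forall>y\<in>C. bracket y x = 0}"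
  have subR: "subspace R"
    unfolding R_def
    by (rule subspaceI)
      (auto simp: bracket_linear subspace_second_center subspace_add subspace_scale subspace_0)
  obtain H0 where H0: "subspace H0" "H0 \<subseteq> C" "R \<inter> H0 = {0}" "R + H0 = C"
    using subspace_complement[OF subR subspace_second_center] by (auto simp: R_def)
  \<comment> \<open>\<open>R\<close> is orthogonal to all of \<open>C = R + H0\<close>, so a vector
    of \<open>H0\<close> orthogonal to \<open>H0\<close> lies in \<open>R\<close> as well.\<close>
  have nd: "h = 0" if h: "h \<in> H0" "\<And>y. y \<in> H0 \<Longrightarrow> \<zeta> (bracket y h) = 0" for h
  proof -
    have "bracket y h = 0" if "y \<in> C" for y
    proof -
      have "y \<in> R + H0"
        using that H0 by simp
      then obtain r y' where y: "r \<in> R" "y' \<in> H0" "y = r + y'"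
        by (rule set_plus_elim)
      have "bracket y' h = 0"
        using y h H0 by (auto intro!: center_coord_zero bracket_second_center)
      moreover have "bracket r h = 0"
        using y h H0 bracket_skew[of r h] by (auto simp: R_def)
      ultimately show ?thesis
        using y by (simp add: bracket_linear)
    qed
    then have "h \<in> R"
      using h H0 by (auto simp: R_def)
    then show ?thesis
      using h H0 by blast
  qed
  define P where "P L \<longleftrightarrow> subspace L \<and> L \<subseteq> H0 \<and> (\<forall>x\<in>L. \<forall>y\<in>L. bracket x y = 0)" for L
  have "P {0}"
    using H0 by (auto simp: P_def subspace_0)
  then obtain L where "P L" and max: "\<And>L'. P L' \<Longrightarrow> dim L' \<le> dim L"
    using ex_maximal_dim[where f = "\<lambda>L. L"] by metis
  then have L: "subspace L" "L \<subseteq> H0" and isoL: "\<And>x y. x \<in> L \<Longrightarrow> y \<in> L \<Longrightarrow> bracket x y = 0"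
    by (auto simp: P_def)
  \<comment> \<open>A vector that commutes with \<open>L\<close> can be adjoined to
    \<open>L\<close>, so maximality makes \<open>L\<close> its own orthogonal space in
    \<open>H0\<close>. Hence \<open>L\<close> is dual to any complement of it in
    \<open>H0\<close>.\<close>
  have lagrangian: "h \<in> L" if h: "h \<in> H0" "\<And>x. x \<in> L \<Longrightarrow> bracket x h = 0" for h
  proof (rule ccontr)
    assume nh: "h \<notin> L"
    let ?L' = "span (insert h L)"
    have "bracket x y = 0" if xy: "x \<in> ?L'" "y \<in> ?L'" for x y
    proof -
      obtain l a l' a' where "l \<in> L" "x = l + scale a h" "l' \<in> L" "y = l' + scale a' h"
        using xy L by (auto simp: span_insert_subspace)
      then show ?thesis
        using isoL h bracket_skew[of h l'] by (simp add: bracket_linear bracket_alternating)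
    qed
    moreover have "?L' \<subseteq> H0"
      using h L H0 by (intro span_minimal) auto
    ultimately have "P ?L'"
      by (simp add: P_def)
    moreover have "dim L < dim ?L'"
      using nh L by (intro dim_less_dim[of _ _ h]) (auto simp: span_base)
    ultimately show False
      using max by fastforce
  qed
  obtain W0 where W0: "subspace W0" "W0 \<subseteq> H0" "L \<inter> W0 = {0}" "L + W0 = H0"
    using subspace_complement[OF L(1) H0(1) L(2)] .
  have ndW0: "w = 0" if w: "w \<in> W0" "\<And>x. x \<in> L \<Longrightarrow> \<zeta> (bracket x w) = 0" for w
  proof -
    have "bracket x w = 0" if "x \<in> L" for x
      using w that L(2) H0(2) by (auto intro!: center_coord_zero bracket_second_center)
    then have "w \<in> L"
      using lagrangian w W0 by blast
    then show ?thesis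
      using w W0 by blast
  qed
  have ndL0: "x = 0" if x: "x \<in> L" "\<And>w. w \<in> W0 \<Longrightarrow> \<zeta> (bracket x w) = 0" for x
  proof (rule nd)
    show "x \<in> H0"
      using x L by auto
    show "\<zeta> (bracket y x) = 0" if "y \<in> H0" for y
    proof -
      obtain l w where "l \<in> L" "w \<in> W0" "y = l + w"
        using \<open>y \<in> H0\<close> W0 by (auto elim!: set_plus_elim)
      then show ?thesis
        using x isoL bracket_skew[of w x] by (simp add: bracket_linear)
    qed
  qed
  obtain W where W: "subspace W"
    and isoW: "\<And>v w. v \<in> W \<Longrightarrow> w \<in> W \<Longrightarrow> \<zeta> (bracket v w) = 0"
    and WW0: "\<And>w. w \<in> W \<Longrightarrow> \<exists>v\<in>W0. w - v \<in> L"
    and W0W: "\<And>v. v \<in> W0 \<Longrightarrow> \<exists>w\<in>W. w - v \<in> L"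
    and LW: "L \<inter> W = {0}"
    by (rule isotropic_complement[OF two L(1) W0(1) _ ndW0 ndL0]) (simp add: isoL, assumption+, rule that)
  have LW_H0: "L + W = H0"
  proof
    show "L + W \<subseteq> H0"
    proof
      fix x assume "x \<in> L + W"
      then obtain l w where lw: "l \<in> L" "w \<in> W" "x = l + w"
        by (auto elim!: set_plus_elim)
      obtain v where v: "v \<in> W0" "w - v \<in> L"
        using WW0 lw by blast
      have "x = (l + (w - v)) + v"
        using lw by simp
      also have "\<dots> \<in> L + W0"
        using v lw L by (intro set_plus_intro) (auto simp: subspace_add)
      finally show "x \<in> H0"
        using W0 by simp
    qed
    show "H0 \<subseteq> L + W"
    proof
      fix x assume "x \<in> H0"
      then obtain l v where lv: "l \<in> L" "v \<in> W0" "x = l + v"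
        using W0 by (auto elim!: set_plus_elim)
      obtain w where w: "w \<in> W" "w - v \<in> L"
        using W0W lv by blast
      have "x = (l - (w - v)) + w"
        using lv by simp
      also have "\<dots> \<in> L + W"
        using w lv L by (intro set_plus_intro) (auto simp: subspace_diff)
      finally show "x \<in> L + W" .
    qed
  qed
  have W_H0: "W \<subseteq> H0"
    using LW_H0 L set_plus_intro[of 0 L _ W] by (auto simp: subspace_0)
  let ?H = "Z + L + W"
  have heis: "heisenberg ?H"
  proof (rule heisenbergI)
    show "x = 0" if x: "x \<in> L" "\<And>w. w \<in> W \<Longrightarrow> \<zeta> (bracket x w) = 0" for x
    proof (rule nd)
      show "x \<in> H0"
        using x L by auto
      show "\<zeta> (bracket y x) = 0" if "y \<in> H0" for y
      proof -
        obtain l w where "l \<in> L" "w \<in> W" "y = l + w"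
          using \<open>y \<in> H0\<close> LW_H0 by (auto elim!: set_plus_elim)
        then show ?thesis
          using x isoL bracket_skew[of w x] by (simp add: bracket_linear)
      qed
    qed
    show "w = 0" if w: "w \<in> W" "\<And>x. x \<in> L \<Longrightarrow> \<zeta> (bracket x w) = 0" for w
    proof (rule nd)
      show "w \<in> H0"
        using w W_H0 by auto
      show "\<zeta> (bracket y w) = 0" if "y \<in> H0" for y
      proof -
        obtain l v where "l \<in> L" "v \<in> W" "y = l + v"
          using \<open>y \<in> H0\<close> LW_H0 by (auto elim!: set_plus_elim)
        then show ?thesis
          using w isoW by (simp add: bracket_linear coord_add)
      qed
    qed
    show "bracket x y = 0" if "x \<in> W" "y \<in> W" for x y
      using that isoW W_H0 H0 by (auto intro!: center_coord_zero bracket_second_center)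
  qed (use L W isoL W_H0 H0 in auto)
  have H_eq: "?H = Z + H0"
    using LW_H0 by (simp add: add.assoc)
  define A where "A = {x. \<forall>h\<in>H0. bracket h x = 0}"
  have subA: "subspace A"
    unfolding A_def by (rule subspaceI) (auto simp: bracket_linear)
  have A_H0: "bracket x h = 0" "bracket h x = 0" if "x \<in> A" "h \<in> H0" for x h
    using that bracket_skew[of x h] by (auto simp: A_def)
  have algA: "subalgebra A"
    unfolding subalgebra_def
  proof (intro conjI ballI)
    fix x y assume xy: "x \<in> A" "y \<in> A"
    have "bracket (bracket x y) h = 0" if "h \<in> H0" for h
      using xy that A_H0 by (simp add: jacobi_left)
    then show "bracket x y \<in> A"
      using bracket_skew[of _ "bracket x y"] by (simp add: A_def)
  qed (rule subA)
  have Z_A: "Z \<subseteq> A"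
    by (auto simp: A_def)
  have span_all: "\<exists>h\<in>H0. \<exists>a\<in>A. x = h + a" for x
  proof -
    \<comment> \<open>Brackets with \<open>H0\<close> \<subseteq> \<open>C\<close> are central,
      hence determined by \<zeta>. Thus \<open>x\<close> acts on \<open>H0\<close> through a
      functional, which some \<open>h\<close> in \<open>H0\<close> represents; then
      \<open>x - h\<close> centralizes \<open>H0\<close>.\<close>
    obtain h where h: "h \<in> H0" "\<And>y. y \<in> H0 \<Longrightarrow> \<zeta> (bracket h y) = \<zeta> (bracket x y)"
      by (rule represent_functional[OF H0(1) H0(1) nd, of "\<lambda>y. \<zeta> (bracket x y)"])
        (auto simp: form_linear)
    have "bracket (x - h) y = 0" if "y \<in> H0" for y
      using h that H0
      by (intro center_coord_zero) (auto simp: form_diff intro!: bracket_second_center(1))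
    then have "x - h \<in> A"
      using bracket_skew[of _ "x - h"] by (simp add: A_def)
    then show ?thesis
      using h(1) by (intro bexI[of _ h] bexI[of _ "x - h"]) auto
  qed
  have HA: "?H \<inter> A = Z"
  proof
    show "?H \<inter> A \<subseteq> Z"
    proof
      fix x assume "x \<in> ?H \<inter> A"
      then obtain z h where zh: "z \<in> Z" "h \<in> H0" "x = z + h" "x \<in> A"
        unfolding H_eq by (auto elim!: set_plus_elim)
      have "h = 0"
      proof (rule nd)
        show "\<zeta> (bracket y h) = 0" if "y \<in> H0" for y
          using zh A_H0[of x y] that by (simp add: bracket_linear)
      qed (use zh in auto)
      then show "x \<in> Z"
        using zh by simp
    qed
    show "Z \<subseteq> ?H \<inter> A"
      using Z_A set_plus_intro[of _ Z 0 H0] H0 by (auto simp: H_eq subspace_0)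
  qed
  have ZA: "center A = Z"
  proof
    show "center A \<subseteq> Z"
    proof
      fix x assume "x \<in> center A"
      then have xA: "x \<in> A" "\<And>a. a \<in> A \<Longrightarrow> bracket a x = 0"
        unfolding center_def by blast+
      have "bracket y x = 0" for y
      proof -
        obtain h a where "h \<in> H0" "a \<in> A" "y = h + a"
          using span_all[of y] by blast
        then show ?thesis
          using xA A_H0(2)[of x h] by (simp add: bracket_add_left)
      qed
      then show "x \<in> Z"
        unfolding center_iff by blast
    qed
    show "Z \<subseteq> center A"
      using Z_A unfolding center_def by blast
  qed
  have red: "reduced_direct UNIV ?H A"
    unfolding reduced_direct_def reduced_semidirect_def
  proof (intro conjI)
    have 0: "bracket x a = 0" "bracket a x = 0" if "x \<in> ?H" "a \<in> A" for x a
      using that A_H0 unfolding H_eq by (auto elim!: set_plus_elim simp: bracket_linear)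
    then show "bracket_set ?H A = {0}"
      by (simp add: bracket_set_eq_zero_iff)
    have "bracket_set A ?H = {0}"
      using 0 by (simp add: bracket_set_eq_zero_iff)
    then show "bracket_set A ?H \<subseteq> ?H"
      using heis by (simp add: heisenberg_def subalgebra_def subspace_0)
    have "x \<in> ?H + A" for x
    proof -
      obtain h a where "h \<in> H0" "a \<in> A" "x = (0 + h) + a"
        using span_all[of x] by auto
      then show ?thesis
        unfolding H_eq using subspace_0[OF subspace_center] by (metis set_plus_intro)
    qed
    then show "UNIV = ?H + A"
      by auto
  qed (use heis algA HA dim_center in \<open>auto simp: heisenberg_def subalgebra_def\<close>)
  \<comment> \<open>Such an \<open>x\<close> commutes with \<open>H0\<close> and brackets
    \<open>A\<close> into \<open>center A = Z\<close>, so it lies in \<open>C\<close>. Its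
    \<open>H0\<close> component is then orthogonal to \<open>H0\<close> and vanishes.\<close>
  have "x \<in> R" if x: "x \<in> second_center A" for x
  proof -
    have xA: "x \<in> A"
      using x by (simp add: second_center_def)
    have *: "bracket y x \<in> Z" if "y \<in> A" for y
    proof -
      have "bracket y x \<in> center A"
        using x algA that unfolding second_center_def center_def subalgebra_def by blast
      then show ?thesis
        by (simp only: ZA)
    qed
    have "bracket y x \<in> Z" for y
    proof -
      obtain h a where "h \<in> H0" "a \<in> A" "y = h + a"
        using span_all[of y] by auto
      then show ?thesis
        using A_H0(2)[OF xA] * by (simp add: bracket_linear)
    qed
    then have xC: "x \<in> C"
      by (simp add: second_center_iff)
    then have "x \<in> R + H0"
      using H0 by simp
    then obtain r h where rh: "r \<in> R" "h \<in> H0" "x = r + h"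
      by (rule set_plus_elim)
    have "h = 0"
    proof (rule nd)
      show "\<zeta> (bracket y h) = 0" if "y \<in> H0" for y
      proof -
        have "bracket y r = 0"
          using that rh H0 by (auto simp: R_def)
        then show ?thesis
          using A_H0(2)[OF xA that] rh by (simp add: bracket_linear)
      qed
    qed (use rh in auto)
    then show ?thesis
      using rh by simp
  qed
  then have "bracket_set (second_center A) (second_center A) = {0}"
    unfolding bracket_set_eq_zero_iff by (auto simp: R_def)
  then have "type_A A"
    using algA nilpotent_subspace[OF nil _ subA] dim_center
    by (simp add: type_A_def nilpotent_dim1_center_def ZA)
  then show ?thesis
    using red heis by blast
qed

end

section \<open>Three-step nilpotent Lie algebras of type (A)\<close>

locale three_step_lie_algebra = lie_algebra_dim1_center scale Basis bracket e \<zeta>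
  for scale :: "'k::field \<Rightarrow> 'v::ab_group_add \<Rightarrow> 'v" and Basis :: "'v set"
    and bracket :: "'v \<Rightarrow> 'v \<Rightarrow> 'v" and e :: 'v and \<zeta> :: "'v \<Rightarrow> 'k" +
  assumes second_center_abelian: "x \<in> second_center UNIV \<Longrightarrow> y \<in> second_center UNIV \<Longrightarrow> bracket x y = 0"
    and bracket_in_second_center: "bracket x y \<in> second_center UNIV"
begin

definition D :: "'v set" where
  "D = {x. \<forall>c\<in>C. bracket c x = 0}"

lemma subspace_D: "subspace D"
  unfolding D_def by (rule subspaceI) (auto simp: bracket_linear)

lemma bracket_D: "d \<in> D \<Longrightarrow> c \<in> C \<Longrightarrow> bracket c d = 0" "d \<in> D \<Longrightarrow> c \<in> C \<Longrightarrow> bracket d c = 0"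
  using bracket_skew[of c d] by (auto simp: D_def)

lemma second_center_subset_D: "C \<subseteq> D"
  by (auto simp: D_def second_center_abelian)

text \<open>By Jacobi, [[d, d'], v] is a difference of brackets of \<open>D\<close> with [d', v] and
  [d, v], which lie in \<open>C\<close>.\<close>

lemma bracket_D_D:
  assumes "d \<in> D" "d' \<in> D"
  shows "bracket d d' \<in> Z"
proof -
  have "bracket (bracket d d') v = 0" for v
    using assms by (simp add: jacobi_left bracket_D bracket_in_second_center)
  then show ?thesis
    unfolding center_iff using bracket_skew[of "bracket d d'"] by simp
qed

text \<open>The bracket U \<times> U \<rightarrow> C / Z has zero radical. This is not a property of
  \<open>U + D\<close>: it depends on which subspace represents the image modulo
  \<open>D\<close>.\<close>

definition radical_free :: "'v set \<Rightarrow> bool" where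
  "radical_free U \<longleftrightarrow> subspace U \<and> U \<inter> D \<subseteq> {0} \<and> (\<forall>u\<in>U. (\<forall>y\<in>U. bracket u y \<in> Z) \<longrightarrow> u = 0)"

text \<open>Together with \<open>center_add_iff\<close>, this lets the simplifier calculate modulo
  \<open>Z\<close>.\<close>

lemma scale_in_center_iff: "scale a x \<in> Z \<longleftrightarrow> a = 0 \<or> x \<in> Z"
proof
  assume *: "scale a x \<in> Z"
  show "a = 0 \<or> x \<in> Z"
  proof (cases "a = 0")
    case False
    then show ?thesis
      using subspace_scale[OF subspace_center *, of "1/a"] by simp
  qed simp
qed (auto simp: subspace_scale subspace_center subspace_0)

lemma center_add_iff: "x \<in> Z \<Longrightarrow> x + y \<in> Z \<longleftrightarrow> y \<in> Z" "x \<in> Z \<Longrightarrow> y + x \<in> Z \<longleftrightarrow> y \<in> Z"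
  using subspace_add[OF subspace_center, of x y] subspace_diff[OF subspace_center, of "x + y" x]
  by (auto simp: add.commute)

lemma bracket_in_center_commute: "bracket x y \<in> Z \<longleftrightarrow> bracket y x \<in> Z"
  using bracket_skew[of x y] bracket_skew[of y x] subspace_neg[OF subspace_center] by metis

lemma not_in_plus_D:
  assumes "subspace U" "U \<inter> D \<subseteq> {0}" "m \<notin> U + D" "u \<in> U" "u + scale a m \<in> D"
  shows "a = 0" "u = 0"
proof -
  show "a = 0"
  proof (rule ccontr)
    assume "a \<noteq> 0"
    then have "m = scale (1/a) (- u) + scale (1/a) (u + scale a m)"
      by (simp add: scale_right_distrib)
    moreover have "scale (1/a) (- u) \<in> U" "scale (1/a) (u + scale a m) \<in> D"
      using assms subspace_D by (auto intro!: subspace_scale subspace_neg)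
    ultimately show False
      using assms(3) set_plus_intro by metis
  qed
  then show "u = 0"
    using assms by auto
qed

text \<open>Modulo \<open>Z\<close>, \<open>m\<close> and \<open>p\<close> span a plane orthogonal
  to \<open>U\<close> on which the bracket is nonzero. Testing a radical vector against
  \<open>m\<close> and \<open>p\<close> removes its components in the plane, and the rest is a
  radical vector of \<open>U\<close>.\<close>

lemma radical_free_insert_pair:
  assumes "radical_free U"
    and m: "\<And>u. u \<in> U \<Longrightarrow> bracket u m \<in> Z" and p: "\<And>u. u \<in> U \<Longrightarrow> bracket u p \<in> Z"
    and mp: "bracket m p \<notin> Z"
    and D: "\<And>u a b. u \<in> U \<Longrightarrow> u + scale b p + scale a m \<in> D \<Longrightarrow> a = 0 \<and> b = 0"
  shows "radical_free (span (insert m (span (insert p U))))"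
proof -
  have U: "subspace U" "U \<inter> D \<subseteq> {0}" "\<And>u. u \<in> U \<Longrightarrow> (\<And>y. y \<in> U \<Longrightarrow> bracket u y \<in> Z) \<Longrightarrow> u = 0"
    using assms(1) by (auto simp: radical_free_def)
  let ?U' = "span (insert m (span (insert p U)))"
  have elem: "\<exists>u\<in>U. \<exists>a b. x = u + scale b p + scale a m" if "x \<in> ?U'" for x
  proof -
    have "x \<in> {w + scale a m | w a. w \<in> span (insert p U)}"
      using that span_insert_subspace[OF subspace_span, of m "insert p U"] by blast
    then obtain w a where "w \<in> span (insert p U)" "x = w + scale a m"
      by blast
    then show ?thesis
      using span_insert_subspace[OF U(1), of p] by auto
  qed
  have sub: "U \<subseteq> ?U'" "m \<in> ?U'" "p \<in> ?U'"
    by (auto intro!: span_base)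
  have "?U' \<inter> D \<subseteq> {0}"
  proof
    fix x assume x: "x \<in> ?U' \<inter> D"
    then obtain u a b where u: "u \<in> U" "x = u + scale b p + scale a m"
      using elem by blast
    then have "a = 0" "b = 0"
      using D x by auto
    then show "x \<in> {0}"
      using u U x by auto
  qed
  moreover have "x = 0" if x: "x \<in> ?U'" "\<And>y. y \<in> ?U' \<Longrightarrow> bracket x y \<in> Z" for x
  proof -
    obtain u a b where u: "u \<in> U" "x = u + scale b p + scale a m"
      using elem x by blast
    have "scale b (bracket p m) \<in> Z"
      using x(2)[OF sub(2)] m[OF u(1)]
      by (simp add: u bracket_linear bracket_alternating center_add_iff)
    then have b: "b = 0"
      using mp bracket_in_center_commute by (simp add: scale_in_center_iff)
    have "scale a (bracket m p) \<in> Z"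
      using x(2)[OF sub(3)] p[OF u(1)] b
      by (simp add: u bracket_linear bracket_alternating center_add_iff)
    then have a: "a = 0"
      using mp by (simp add: scale_in_center_iff)
    have "u = 0"
      using x(2) sub u a b by (intro U) auto
    then show "x = 0"
      using u a b by simp
  qed
  ultimately show ?thesis
    by (auto simp: radical_free_def)
qed

text \<open>
  The complement \<open>V\<close> has to be chosen so that the bracket \<open>V \<times> V \<rightarrow> C / Z\<close> is either zero or without
  radical: otherwise the second center of \<open>Z + C + V\<close> is neither abelian nor everything. We maximise
  the subspace \<open>U\<close> on which the radical vanishes. A maximal \<open>U\<close> with \<open>U + D \<noteq> UNIV\<close> splits off an
  orthogonal complement \<open>P\<close>, and it can be enlarged by a pair in \<open>P\<close> or by a vector of \<open>P\<close> after
  tilting \<open>U\<close> in the direction of some \<open>d \<in> D\<close>.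
\<close>

lemma ex_dichotomic_complement:
  obtains V where "subspace V" "V \<inter> D = {0}" "V + D = UNIV"
    "(\<forall>v\<in>V. \<forall>w\<in>V. bracket v w \<in> Z) \<or> (\<forall>v\<in>V. (\<forall>w\<in>V. bracket v w \<in> Z) \<longrightarrow> v = 0)"
proof -
  have "radical_free {0}"
    by (auto simp: radical_free_def)
  then obtain U where "radical_free U" and max: "\<And>U'. radical_free U' \<Longrightarrow> dim (U' + D) \<le> dim (U + D)"
    using ex_maximal_dim[where f = "\<lambda>U. U + D" and P = radical_free] by metis
  then have U: "subspace U" "U \<inter> D \<subseteq> {0}"
    and rad: "\<And>u. u \<in> U \<Longrightarrow> (\<And>y. y \<in> U \<Longrightarrow> bracket u y \<in> Z) \<Longrightarrow> u = 0"
    by (auto simp: radical_free_def)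
  \<comment> \<open>Maximality is used modulo \<open>D\<close>: the competitor \<open>U'\<close>
    need not contain \<open>U\<close>, which is what permits tilting.\<close>
  have not_radical_free: "\<not> radical_free U'" if UU': "U \<subseteq> U' + D" "m \<in> U' + D" "m \<notin> U + D" for U' m
  proof
    assume g: "radical_free U'"
    then have U': "subspace U'"
      by (simp add: radical_free_def)
    have "U + D \<subseteq> U' + D"
    proof
      fix x assume "x \<in> U + D"
      then obtain u d where ud: "u \<in> U" "d \<in> D" "x = u + d"
        by (auto elim!: set_plus_elim)
      moreover have "u \<in> U' + D"
        using UU'(1) ud by blast
      then obtain u' d' where "u' \<in> U'" "d' \<in> D" "u = u' + d'"
        by (rule set_plus_elim)
      ultimately have "x = u' + (d' + d)" "u' \<in> U'" "d' + d \<in> D"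
        using subspace_D by (auto simp: subspace_add add.assoc)
      then show "x \<in> U' + D"
        using set_plus_intro by metis
    qed
    then have "dim (U + D) < dim (U' + D)"
      using U U' subspace_D UU' by (intro dim_less_dim[of _ _ m]) (auto simp: subspace_set_plus)
    then show False
      using max[OF g] by simp
  qed
  have subset_plus: "S \<subseteq> S + D" for S
    using subspace_D set_plus_intro[of _ S 0 D] by (auto simp: subspace_0)
  have no_pair: False
    if "\<And>u. u \<in> U \<Longrightarrow> bracket u m \<in> Z" "\<And>u. u \<in> U \<Longrightarrow> bracket u p \<in> Z" "bracket m p \<notin> Z"
      and D: "\<And>u a b. u \<in> U \<Longrightarrow> u + scale b p + scale a m \<in> D \<Longrightarrow> a = 0 \<and> b = 0" for m p
  proof -
    let ?U' = "span (insert m (span (insert p U)))"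
    have "m \<notin> U + D"
    proof
      assume "m \<in> U + D"
      then obtain u d where "u \<in> U" "d \<in> D" "m = u + d"
        by (auto elim!: set_plus_elim)
      then show False
        using D[of "- u" 0 1] U by (simp add: subspace_neg)
    qed
    moreover have "U \<subseteq> ?U'" "m \<in> ?U'"
      by (auto intro!: span_base)
    ultimately have "\<not> radical_free ?U'"
      using not_radical_free[of ?U' m] subset_plus[of ?U'] by blast
    moreover have "radical_free ?U'"
      using that by (intro radical_free_insert_pair[OF \<open>radical_free U\<close>]) blast+
    ultimately show False
      by blast
  qed
  consider "U + D = UNIV" | "U = {0}" | x0 m0 where "x0 \<in> U" "x0 \<noteq> 0" "m0 \<notin> U + D"
    using subspace_0[OF U(1)] by blast
  then show thesis
  proof cases
    case 1
    have "U \<inter> D = {0}"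
      using U subspace_D by (auto simp: subspace_0)
    then show thesis
      using that[OF U(1) _ 1] rad by blast
  next
    case 2
    obtain V where V: "subspace V" "D \<inter> V = {0}" "D + V = UNIV"
      by (rule subspace_complement[OF subspace_D subspace_UNIV subset_UNIV])
    have "bracket m p \<in> Z" if mp: "m \<in> V" "p \<in> V" for m p
    proof (rule ccontr)
      assume n: "bracket m p \<notin> Z"
      show False
      proof (rule no_pair[OF _ _ n])
        fix u a b assume u: "u \<in> U" "u + scale b p + scale a m \<in> D"
        then have "scale b p + scale a m \<in> V" "scale b p + scale a m \<in> D"
          using V mp 2 by (auto simp: subspace_add subspace_scale)
        then have 0: "scale b p + scale a m = 0"
          using V by blast
        then have "bracket (scale b p + scale a m) p = 0" "bracket m (scale b p + scale a m) = 0"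
          by auto
        moreover have "bracket m p \<noteq> 0"
          using n subspace_center by (auto simp: subspace_0)
        ultimately show "a = 0 \<and> b = 0"
          by (simp add: bracket_linear bracket_alternating)
      qed (use 2 subspace_center in \<open>auto simp: subspace_0\<close>)
    qed
    then show thesis
      using that[OF V(1)] V(2,3) by (simp add: add.commute[of D] Int_commute)
  next
    case 3
    define P where "P = {p. \<forall>y\<in>U. bracket p y \<in> Z}"
    have subP: "subspace P"
      unfolding P_def
      by (rule subspaceI)
        (auto simp: bracket_linear subspace_add subspace_scale subspace_0 subspace_center)
    have bracket_P: "bracket p y \<in> Z" "bracket y p \<in> Z" if "p \<in> P" "y \<in> U" for p y
      using that bracket_in_center_commute by (auto simp: P_def)
    \<comment> \<open>By maximality the span of \<open>U\<close> and \<open>m\<close> has a radical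
      vector. It involves \<open>m\<close>, since \<open>U\<close> has no radical, and rescaling it
      gives the desired element of \<open>P\<close>.\<close>
    have step: "\<exists>u\<in>U. u + m \<in> P" if m: "m \<notin> U + D" for m
    proof -
      let ?U' = "span (insert m U)"
      have sub: "U \<subseteq> ?U'" "m \<in> ?U'"
        by (auto intro: span_base)
      then have "\<not> radical_free ?U'"
        using not_radical_free[of ?U' m] subset_plus[of ?U'] m by blast
      moreover have "?U' \<inter> D \<subseteq> {0}"
      proof
        fix x assume "x \<in> ?U' \<inter> D"
        then obtain u a where x: "u \<in> U" "x = u + scale a m" "u + scale a m \<in> D"
          using U by (auto simp: span_insert_subspace)
        then have "a = 0" "u = 0"
          using not_in_plus_D[OF U m] by blast+
        then show "x \<in> {0}"
          using x by simp
      qed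
      ultimately obtain x where x: "x \<in> ?U'" "x \<noteq> 0" "\<And>y. y \<in> ?U' \<Longrightarrow> bracket x y \<in> Z"
        by (auto simp: radical_free_def)
      then obtain u a where u: "u \<in> U" "x = u + scale a m"
        using U by (auto simp: span_insert_subspace)
      have "a \<noteq> 0"
      proof
        assume "a = 0"
        then have "x = 0"
          using x sub u by (intro rad) auto
        then show False
          using x by simp
      qed
      then have "scale (1/a) u + m = scale (1/a) x"
        using u by (simp add: scale_right_distrib)
      moreover have "scale (1/a) x \<in> P"
        using x sub by (auto simp: P_def bracket_linear scale_in_center_iff)
      ultimately show ?thesis
        using u U by (metis subspace_scale)
    qed
    \<comment> \<open>So \<open>U + P\<close> is everything. \<open>step\<close> covers vectors
      outside \<open>U + D\<close>; an element \<open>d\<close> of \<open>D\<close> is the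
      difference of \<open>m0 + d\<close> and \<open>m0\<close>, which both lie outside.\<close>
    have UP: "\<exists>u\<in>U. u + x \<in> P" for x
    proof (cases "x \<in> U + D")
      case True
      then obtain u0 d where x: "u0 \<in> U" "d \<in> D" "x = u0 + d"
        by (auto elim!: set_plus_elim)
      have "m0 + d \<notin> U + D"
      proof
        assume "m0 + d \<in> U + D"
        then obtain u' d' where "u' \<in> U" "d' \<in> D" "m0 + d = u' + d'"
          by (auto elim!: set_plus_elim)
        then have "m0 = u' + (d' - d)" "d' - d \<in> D" "u' \<in> U"
          using x subspace_D by (auto simp: subspace_diff algebra_simps)
        then show False
          using 3 set_plus_intro by metis
      qed
      then obtain u1 u2 where u12: "u1 \<in> U" "u2 \<in> U" "u1 + m0 \<in> P" "u2 + (m0 + d) \<in> P"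
        using step 3 by meson
      then have "(u2 + (m0 + d)) - (u1 + m0) \<in> P"
        using subP subspace_diff by blast
      moreover have "(u2 + (m0 + d)) - (u1 + m0) = (u2 - u1 - u0) + x"
        using x by simp
      moreover have "u2 - u1 - u0 \<in> U"
        using u12 x U by (simp add: subspace_diff)
      ultimately show ?thesis
        by metis
    qed (rule step)
    \<comment> \<open>This and the next two facts say which triple brackets vanish; the surviving
      ones [[d, m], p] with \<open>m\<close>, \<open>p\<close> in \<open>P\<close> will separate the
      components of a vector.\<close>
    have UUP: "bracket (bracket x y) p = 0" if "x \<in> U" "y \<in> U" "p \<in> P" for x y p
      using that bracket_P by (simp add: jacobi_left)
    have DUP: "bracket (bracket d x) p = 0" if dxp: "d \<in> D" "x \<in> U" "p \<in> P" for d x p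
    proof -
      obtain u where u: "u \<in> U" "u + d \<in> P"
        using UP by blast
      have "bracket d x = bracket (u + d) x - bracket u x"
        by (simp add: bracket_linear)
      then show ?thesis
        using UUP u dxp bracket_P(1)[OF u(2)] by (simp add: bracket_linear(5))
    qed
    have DPU: "bracket (bracket d p) x = 0" if "d \<in> D" "x \<in> U" "p \<in> P" for d x p
      using DUP[OF that] that bracket_P bracket_skew[of p "bracket d x"] by (simp add: jacobi_left)
    \<comment> \<open>[d, m] commutes with \<open>U\<close> by \<open>DPU\<close>, so if it also
      commuted with \<open>P\<close> it would be central.\<close>
    have detect: "\<exists>p\<in>P. bracket (bracket d m) p \<noteq> 0"
      if dm: "d \<in> D" "m \<in> P" "bracket d m \<notin> Z" for d m
    proof (rule ccontr)
      assume *: "\<not> ?thesis"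
      have "bracket (bracket d m) x = 0" for x
      proof -
        obtain u where "u \<in> U" "u + x \<in> P"
          using UP by blast
        then have "bracket (bracket d m) u = 0" "bracket (bracket d m) (u + x) = 0"
          using * DPU dm by auto
        then show ?thesis
          by (simp add: bracket_add_right)
      qed
      then have "bracket d m \<in> Z"
        unfolding center_iff using bracket_skew[of "bracket d m"] by simp
      then show False
        using dm by simp
    qed
    show thesis
    proof (cases "\<exists>d\<in>D. \<exists>m\<in>P. bracket d m \<notin> Z")
      case True
      then obtain d m where dm: "d \<in> D" "m \<in> P" "bracket d m \<notin> Z"
        by blast
      obtain q where q: "q \<in> P" "bracket (bracket d m) q \<noteq> 0"
        using detect dm by blast
      have mUD: "m \<notin> U + D"
      proof
        assume "m \<in> U + D"
        then obtain u d' where "u \<in> U" "d' \<in> D" "m = u + d'"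
          by (auto elim!: set_plus_elim)
        then show False
          using q dm DUP bracket_D_D[of d d'] by (simp add: bracket_linear)
      qed
      \<comment> \<open>As \<open>x0\<close> is nonzero in \<open>U\<close>, it is outside
        \<open>D\<close>. This yields a linear functional \<open>s\<close> with \<open>s x0\<close>
        \<noteq> 0, which governs the tilt.\<close>
      obtain c where c: "c \<in> C" "bracket c x0 \<noteq> 0"
        using 3 U by (auto simp: D_def)
      define s where "s x = \<zeta> (bracket c x)" for x
      have s: "s (x + y) = s x + s y" "s (scale a x) = a * s x" for x y a
        by (auto simp: s_def form_linear)
      have sx0: "s x0 \<noteq> 0"
        using c center_coord_zero bracket_second_center by (auto simp: s_def)
      let ?U1 = "{u + scale (s u) d | u. u \<in> U}"
      have U1: "subspace ?U1"
      proof (rule subspaceI)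
        show "0 \<in> ?U1"
          using U by (auto simp: s_def subspace_0 intro!: exI[of _ 0])
        fix x y assume "x \<in> ?U1" "y \<in> ?U1"
        then obtain u v where "u \<in> U" "v \<in> U" "x = u + scale (s u) d" "y = v + scale (s v) d"
          by blast
        then show "x + y \<in> ?U1"
          using U by (intro CollectI exI[of _ "u + v"])
            (auto simp: s subspace_add scale_left_distrib)
      next
        fix a x assume "x \<in> ?U1"
        then obtain u where "u \<in> U" "x = u + scale (s u) d"
          by blast
        then show "scale a x \<in> ?U1"
          using U by (intro CollectI exI[of _ "scale a u"])
            (auto simp: s subspace_scale scale_right_distrib)
      qed
      \<comment> \<open>Testing against the tilted \<open>x0\<close> and then \<open>q\<close>
        removes the coefficient \<open>a\<close>; testing against \<open>m + d\<close> and then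
        \<open>q\<close> gives \<open>s u = 0\<close>. The summand \<open>d\<close> in
        \<open>m + d\<close> yields in addition that [u, d] is central, which reduces tilted test
        vectors to vectors of \<open>U\<close>.\<close>
      let ?U' = "span (insert (m + d) ?U1)"
      have elem: "\<exists>u\<in>U. \<exists>a. x = u + scale (s u) d + scale a (m + d)" if "x \<in> ?U'" for x
        using that by (auto simp: span_insert_subspace[OF U1])
      have sub: "u + scale (s u) d \<in> ?U'" if "u \<in> U" for u
        using that by (intro span_base) auto
      have subm: "m + d \<in> ?U'"
        by (intro span_base) auto
      have "?U' \<inter> D \<subseteq> {0}"
      proof
        fix x assume x: "x \<in> ?U' \<inter> D"
        then obtain u a where u: "u \<in> U" "x = u + scale (s u) d + scale a (m + d)"
          using elem by blast
        have "u + scale a m = x - scale (s u + a) d"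
          by (simp add: u scale_right_distrib scale_left_distrib)
        also have "\<dots> \<in> D"
          using x dm subspace_D by (simp add: subspace_diff subspace_scale)
        finally have "a = 0" "u = 0"
          using not_in_plus_D[OF U mUD u(1)] by auto
        then show "x \<in> {0}"
          using u by (simp add: s_def)
      qed
      moreover have "x = 0" if x: "x \<in> ?U'" "\<And>y. y \<in> ?U' \<Longrightarrow> bracket x y \<in> Z" for x
      proof -
        obtain u a where u: "u \<in> U" "x = u + scale (s u) d + scale a (m + d)"
          using elem x by blast
        have D_skew: "bracket (bracket y d) q = 0" if "y \<in> U" for y
          using DUP[OF dm(1) that q(1)] by (simp add: bracket_skew[of d y])
        have mx0: "bracket m x0 \<in> Z" and um: "bracket u m \<in> Z"
          using bracket_P dm u 3 by auto
        have "bracket (bracket x (x0 + scale (s x0) d)) q = 0"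
          using x(2)[OF sub] 3 by simp
        moreover have "bracket (bracket x (x0 + scale (s x0) d)) q
            = scale (- (a * s x0)) (bracket (bracket d m) q)"
          using UUP[of u x0 q] D_skew[OF u(1)] DUP[of d x0 q] mx0 dm q u 3
          by (simp add: bracket_linear bracket_alternating bracket_skew[of d m])
        ultimately have a: "a = 0"
          using q sx0 by simp
        have "bracket (bracket x (m + d)) q = 0"
          using x(2)[OF subm] by simp
        moreover have "bracket (bracket x (m + d)) q = scale (s u) (bracket (bracket d m) q)"
          using um D_skew[OF u(1)] by (simp add: u a bracket_linear bracket_alternating)
        ultimately have su: "s u = 0"
          using q by simp
        have xu: "x = u"
          using u a su by simp
        have ud: "bracket u d \<in> Z"
          using x(2)[OF subm] um by (simp add: xu bracket_linear center_add_iff)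
        have "bracket u y \<in> Z" if "y \<in> U" for y
        proof -
          have "scale (s y) (bracket u d) \<in> Z"
            using ud by (simp add: scale_in_center_iff)
          then show ?thesis
            using x(2)[OF sub[OF that]] by (simp add: xu bracket_linear center_add_iff)
        qed
        then show "x = 0"
          using rad u xu by blast
      qed
      ultimately have "radical_free ?U'"
        by (auto simp: radical_free_def)
      moreover have "U \<subseteq> ?U' + D"
      proof
        fix u assume "u \<in> U"
        then have "(u + scale (s u) d) + scale (- s u) d \<in> ?U' + D"
          using sub dm subspace_D by (intro set_plus_intro subspace_scale)
        then show "u \<in> ?U' + D"
          by simp
      qed
      moreover have "(m + d) + (- d) \<in> ?U' + D"
        using subm dm subspace_D by (intro set_plus_intro subspace_neg)
      then have "m \<in> ?U' + D"
        by simp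
      ultimately show thesis
        using not_radical_free mUD by blast
    next
      case False
      then have DP: "bracket d m \<in> Z" if "d \<in> D" "m \<in> P" for d m
        using that by blast
      obtain u where u: "u \<in> U" "u + m0 \<in> P"
        using UP by blast
      define m where "m = u + m0"
      have m: "m \<in> P"
        using u by (simp add: m_def)
      have "m \<notin> D"
      proof
        assume "m \<in> D"
        then have "- u + m \<in> U + D"
          using u U by (intro set_plus_intro) (auto simp: subspace_neg)
        then show False
          using 3 by (simp add: m_def)
      qed
      then have "m \<notin> C"
        using second_center_subset_D by blast
      \<comment> \<open>Now \<open>D\<close> and \<open>P\<close> commute modulo \<open>Z\<close>.
        Moving \<open>y\<close> into \<open>P\<close> by an element of \<open>U\<close> keeps its
        bracket with \<open>m\<close> outside \<open>Z\<close>, so a pair excluded by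
        \<open>no_pair\<close> appears.\<close>
      then obtain y where y: "bracket y m \<notin> Z"
        by (auto simp: second_center_iff)
      obtain v where v: "v \<in> U" "v + y \<in> P"
        using UP by blast
      let ?p = "v + y"
      have mp: "bracket m ?p \<notin> Z"
        using y bracket_P(2)[OF m v(1)] bracket_in_center_commute[of m ?p]
        by (simp add: bracket_add_left center_add_iff)
      have False
      proof (rule no_pair[OF _ _ mp])
        fix w a b assume w: "w \<in> U" "w + scale b ?p + scale a m \<in> D"
        have wm: "bracket w m \<in> Z" "bracket w ?p \<in> Z"
          using w bracket_P m v by auto
        have "scale b (bracket ?p m) \<in> Z"
          using DP[OF w(2) m] wm
          by (simp add: bracket_add_left[of _ "scale a m"] bracket_add_left[of w] bracket_scale_left
              bracket_alternating center_add_iff)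
        then have "b = 0"
          using mp bracket_in_center_commute by (simp add: scale_in_center_iff)
        moreover have "scale a (bracket m ?p) \<in> Z"
          using DP[OF w(2) v(2)] wm \<open>b = 0\<close>
          by (simp add: bracket_add_left[of w] bracket_scale_left center_add_iff)
        then have "a = 0"
          using mp by (simp add: scale_in_center_iff)
        ultimately show "a = 0 \<and> b = 0"
          by simp
      qed (use bracket_P m v in auto)
      then show thesis ..
    qed
  qed
qed

section \<open>The abelian part of the grading and its duality with a complement of
  \<open>D\<close>\<close>

definition X :: "'v set" where
  "X = {x \<in> C. \<zeta> x = 0}"

lemma subspace_X: "subspace X"
  unfolding X_def
  by (rule subspaceI)
    (auto simp: subspace_second_center subspace_0 subspace_add subspace_scale coord_add coord_scale)

lemma center_plus_X: "Z + X = C"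
proof
  show "Z + X \<subseteq> C"
    using center_subset_second_center subspace_second_center
    by (auto elim!: set_plus_elim simp: X_def intro!: subspace_add)
  show "C \<subseteq> Z + X"
  proof
    fix c assume c: "c \<in> C"
    have "c - scale (\<zeta> c) e \<in> X"
      using c center_subset_second_center scale_in_center subspace_second_center
      by (auto simp: X_def coord_diff coord_scale coord_one intro!: subspace_diff)
    then have "scale (\<zeta> c) e + (c - scale (\<zeta> c) e) \<in> Z + X"
      using scale_in_center by (intro set_plus_intro)
    then show "c \<in> Z + X"
      by simp
  qed
qed

text \<open>An element of \<open>C\<close> commutes with \<open>D\<close> anyway, so orthogonality
  to \<open>V\<close> makes it central, and \<zeta> vanishes on \<open>X\<close>.\<close>

lemma nondegenerate_X:
  assumes "V + D = UNIV" "x \<in> X" "\<And>v. v \<in> V \<Longrightarrow> \<zeta> (bracket x v) = 0"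
  shows "x = 0"
proof -
  have x: "x \<in> C" "\<zeta> x = 0"
    using assms by (auto simp: X_def)
  have "bracket y x = 0" for y
  proof -
    have "y \<in> V + D"
      using assms by simp
    then obtain v d where "v \<in> V" "d \<in> D" "y = v + d"
      by (rule set_plus_elim)
    then have "bracket x y = 0"
      using x assms(3) by (simp add: bracket_add_right bracket_D center_coord_zero bracket_second_center)
    then show ?thesis
      using bracket_skew[of x y] by simp
  qed
  then have "x \<in> Z"
    unfolding center_iff by blast
  then show ?thesis
    using x center_coord_zero by blast
qed

text \<open>The other half of the duality: \<open>X\<close> and \<open>Z\<close> span
  \<open>C\<close>, and brackets with \<open>C\<close> are determined by \<zeta>.\<close>

lemma in_D_if_orthogonal_X:
  assumes "\<And>x. x \<in> X \<Longrightarrow> \<zeta> (bracket x v) = 0"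
  shows "v \<in> D"
  unfolding D_def
proof (intro CollectI ballI)
  fix c assume "c \<in> C"
  then have "c \<in> Z + X"
    by (simp add: center_plus_X)
  then obtain z x where c: "z \<in> Z" "x \<in> X" "c = z + x"
    by (rule set_plus_elim)
  then have "bracket x v = 0"
    using assms by (intro center_coord_zero bracket_second_center) (auto simp: X_def)
  then show "bracket c v = 0"
    using c by (simp add: bracket_linear)
qed

lemma ex_isotropic_dichotomic_complement:
  assumes two: "(2::'k) \<noteq> 0"
  obtains V where "subspace V" "V \<inter> D = {0}" "V + D = UNIV"
    "\<And>v w. v \<in> V \<Longrightarrow> w \<in> V \<Longrightarrow> \<zeta> (bracket v w) = 0"
    "(\<forall>v\<in>V. \<forall>w\<in>V. bracket v w \<in> Z) \<or> (\<forall>v\<in>V. (\<forall>w\<in>V. bracket v w \<in> Z) \<longrightarrow> v = 0)"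
proof -
  obtain V where V: "subspace V" "V \<inter> D = {0}" "V + D = UNIV"
    and dich: "(\<forall>v\<in>V. \<forall>w\<in>V. bracket v w \<in> Z) \<or> (\<forall>v\<in>V. (\<forall>w\<in>V. bracket v w \<in> Z) \<longrightarrow> v = 0)"
    by (rule ex_dichotomic_complement)
  have isoX: "\<zeta> (bracket x y) = 0" if "x \<in> X" "y \<in> X" for x y
    using that second_center_abelian by (simp add: X_def)
  have ndV: "v = 0" if "v \<in> V" "\<And>x. x \<in> X \<Longrightarrow> \<zeta> (bracket x v) = 0" for v
    using in_D_if_orthogonal_X[OF that(2)] that(1) V by auto
  obtain W where W: "subspace W"
    and isoW: "\<And>v w. v \<in> W \<Longrightarrow> w \<in> W \<Longrightarrow> \<zeta> (bracket v w) = 0"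
    and WV: "\<And>w. w \<in> W \<Longrightarrow> \<exists>v\<in>V. w - v \<in> X"
    and VW: "\<And>v. v \<in> V \<Longrightarrow> \<exists>w\<in>W. w - v \<in> X"
    and XW: "X \<inter> W = {0}"
    by (rule isotropic_complement[OF two subspace_X V(1) isoX ndV nondegenerate_X[OF V(3)]])
      (assumption+, rule that)
  have X_D: "X \<subseteq> D"
    using second_center_subset_D by (auto simp: X_def)
  have WD: "w = 0" if w: "w \<in> W" "w \<in> D" for w
  proof -
    obtain v where v: "v \<in> V" "w - v \<in> X"
      using WV w by blast
    have "w - (w - v) \<in> D"
      by (rule subspace_diff[OF subspace_D w(2) subsetD[OF X_D v(2)]])
    then have "v = 0"
      using v V by auto
    then show ?thesis
      using v w XW by auto
  qed
  have "x \<in> W + D" for x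
  proof -
    have "x \<in> V + D"
      using V by simp
    then obtain v d where vd: "v \<in> V" "d \<in> D" "x = v + d"
      by (rule set_plus_elim)
    obtain w where w: "w \<in> W" "w - v \<in> X"
      using VW vd by blast
    have "d - (w - v) \<in> D"
      by (rule subspace_diff[OF subspace_D vd(2) subsetD[OF X_D w(2)]])
    then have "w + (d - (w - v)) \<in> W + D"
      using w by (intro set_plus_intro)
    then show ?thesis
      using vd by (simp add: add.commute)
  qed
  then have WD_UNIV: "W + D = UNIV"
    by auto
  \<comment> \<open>The correction by elements of \<open>X\<close> is invisible modulo
    \<open>Z\<close>, so both alternatives pass from \<open>V\<close> to \<open>W\<close>.\<close>
  have mod_X: "bracket a b \<in> Z \<longleftrightarrow> bracket v w \<in> Z" if "a - v \<in> X" "b - w \<in> X" for a b v w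
  proof -
    have "a - v \<in> C" "b - w \<in> C"
      using that by (auto simp: X_def)
    then have "bracket (a - v) b \<in> Z" "bracket v (b - w) \<in> Z"
      using bracket_second_center by auto
    then have "bracket (a - v) b + bracket v (b - w) \<in> Z"
      using subspace_add subspace_center by blast
    moreover have "bracket a b = (bracket (a - v) b + bracket v (b - w)) + bracket v w"
      by (simp add: bracket_diff)
    ultimately show ?thesis
      by (simp add: center_add_iff)
  qed
  have "(\<forall>v\<in>W. \<forall>w\<in>W. bracket v w \<in> Z) \<or> (\<forall>v\<in>W. (\<forall>w\<in>W. bracket v w \<in> Z) \<longrightarrow> v = 0)"
    using dich
  proof
    assume "\<forall>v\<in>V. \<forall>w\<in>V. bracket v w \<in> Z"
    then have "\<forall>v\<in>W. \<forall>w\<in>W. bracket v w \<in> Z"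
      using WV mod_X by meson
    then show ?thesis ..
  next
    assume rad: "\<forall>v\<in>V. (\<forall>w\<in>V. bracket v w \<in> Z) \<longrightarrow> v = 0"
    have "a = 0" if a: "a \<in> W" "\<forall>b\<in>W. bracket a b \<in> Z" for a
    proof -
      obtain v where v: "v \<in> V" "a - v \<in> X"
        using WV a by blast
      have "bracket v w \<in> Z" if "w \<in> V" for w
        using VW[OF that] a(2) mod_X[OF v(2)] by blast
      then have "v = 0"
        using rad v by blast
      then show ?thesis
        using v a XW by auto
    qed
    then show ?thesis
      by blast
  qed
  moreover have "W \<inter> D = {0}"
    using WD W subspace_D by (auto simp: subspace_0)
  ultimately show thesis
    using that[OF W _ WD_UNIV isoW] by blast
qed

lemma reduced_semidirect_decomposition:
  assumes two: "(2::'k) \<noteq> 0" and nil: "nilpotent UNIV"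
  shows "\<exists>K1 A. reduced_semidirect UNIV K1 A \<and> type_A_plus K1 \<and> two_step_nilpotent A \<and>
    bracket_set A A \<subseteq> Z \<and> (\<exists>\<gamma>. grading_A_plus K1 \<gamma> \<and> compatible A K1 \<gamma>)"
proof -
  obtain V where V: "subspace V" and VD: "V \<inter> D = {0}" and V_D: "V + D = UNIV"
    and isoV: "\<And>v w. v \<in> V \<Longrightarrow> w \<in> V \<Longrightarrow> \<zeta> (bracket v w) = 0"
    and dich: "(\<forall>v\<in>V. \<forall>w\<in>V. bracket v w \<in> Z) \<or> (\<forall>v\<in>V. (\<forall>w\<in>V. bracket v w \<in> Z) \<longrightarrow> v = 0)"
    by (rule ex_isotropic_dichotomic_complement[OF two], rule that)
  let ?K = "Z + X + V"
  have K_eq: "?K = C + V"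
    by (simp add: center_plus_X)
  have X_C: "X \<subseteq> C"
    by (auto simp: X_def)
  have C_K: "C \<subseteq> ?K" and V_K: "V \<subseteq> ?K"
    unfolding K_eq
    using set_plus_intro[of _ C 0 V] set_plus_intro[of 0 C _ V] subspace_second_center V
    by (auto simp: subspace_0)
  have K_elim: "\<exists>c\<in>C. \<exists>v\<in>V. x = c + v" if "x \<in> ?K" for x
    using that unfolding K_eq by (rule set_plus_elim) blast
  have ndV: "v = 0" if "v \<in> V" "\<And>x. x \<in> X \<Longrightarrow> \<zeta> (bracket x v) = 0" for v
    using in_D_if_orthogonal_X[OF that(2)] that(1) VD by auto
  have algK: "subalgebra ?K"
    unfolding subalgebra_def
    using subspace_center subspace_X V C_K bracket_in_second_center
    by (auto intro: subspace_set_plus)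
  have commute_Z: "c \<in> Z" if c: "c \<in> C" "\<And>v. v \<in> V \<Longrightarrow> bracket v c = 0" for c
  proof -
    have "bracket y c = 0" for y
    proof -
      have "y \<in> V + D"
        using V_D by simp
      then obtain v d where "v \<in> V" "d \<in> D" "y = v + d"
        by (rule set_plus_elim)
      then show ?thesis
        using c by (simp add: bracket_add_left bracket_D)
    qed
    then show ?thesis
      unfolding center_iff by blast
  qed
  have centerK: "center ?K = Z"
  proof
    show "Z \<subseteq> center ?K"
      using C_K center_subset_second_center unfolding center_def by blast
    show "center ?K \<subseteq> Z"
    proof
      fix x assume "x \<in> center ?K"
      then have x: "x \<in> ?K" "\<And>y. y \<in> ?K \<Longrightarrow> bracket y x = 0"
        unfolding center_def by blast+
      obtain c v where cv: "c \<in> C" "v \<in> V" "x = c + v"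
        using K_elim[OF x(1)] by blast
      \<comment> \<open>The \<open>C\<close> component of \<open>x\<close> commutes with
        \<open>X\<close>, so only \<open>v\<close> is tested.\<close>
      have "bracket y v = 0" if "y \<in> X" for y
      proof -
        have "y \<in> C" "y \<in> ?K"
          using that X_C C_K by blast+
        then show ?thesis
          using x(2)[of y] cv second_center_abelian[of y c] by (simp add: bracket_add_right)
      qed
      then have "v = 0"
        using ndV cv by simp
      then show "x \<in> Z"
        using commute_Z cv x(2) V_K by auto
    qed
  qed
  have nilK: "nilpotent_dim1_center ?K"
    using algK nilpotent_subspace[OF nil] dim_center
    by (simp add: nilpotent_dim1_center_def centerK subalgebra_def)
  have grading: "grading_A_plus ?K (Z, X, V)"
    unfolding grading_A_plus_def prod.case
  proof (intro conjI)
    have "z = 0 \<and> x = 0 \<and> v = 0" if zxv: "z \<in> Z" "x \<in> X" "v \<in> V" "z + x + v = 0" for z x v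
    proof -
      have zx: "z + x \<in> C"
        using zxv X_C center_subset_second_center subspace_second_center by (auto intro: subspace_add)
      have v: "v = - (z + x)"
        using zxv(4) by (metis add.commute eq_neg_iff_add_eq_0)
      then have "v \<in> D"
        using zx subspace_neg[OF subspace_second_center] second_center_subset_D by blast
      then have v0: "v = 0"
        using zxv VD by auto
      then have "z + x = 0"
        using zxv by simp
      moreover have "\<zeta> x = 0"
        using zxv by (simp add: X_def)
      ultimately have "z = 0"
        using zxv coord_add[of z x] center_coord_zero by simp
      then show ?thesis
        using v0 zxv by simp
    qed
    then show "direct_sum3 ?K Z X V"
      using subspace_center subspace_X V unfolding direct_sum3_def by blast
    show "bracket_set X X = {0}"
      using second_center_abelian X_C by (auto simp: bracket_set_eq_zero_iff)
    show "bracket_set V V \<subseteq> X"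
      using isoV bracket_in_second_center by (intro bracket_set_subset subspace_X) (simp add: X_def)
    show "bracket_set X V \<subseteq> center ?K"
      unfolding centerK using X_C bracket_second_center by (intro bracket_set_subset subspace_center) auto
    show "\<forall>x\<in>X. (\<forall>v\<in>V. bracket x v = 0) \<longrightarrow> x = 0"
      using nondegenerate_X[OF V_D] by auto
    show "\<forall>v\<in>V. (\<forall>x\<in>X. bracket x v = 0) \<longrightarrow> v = 0"
      using ndV by auto
  qed (use nilK centerK in auto)
  \<comment> \<open>If [V, V] is central, all brackets of \<open>?K\<close> are. Otherwise a second
    central element has a radical vector of \<open>V\<close> as its \<open>V\<close> component, so
    the second center of \<open>?K\<close> is exactly \<open>C\<close>.\<close>
  have "maximal_abelian ?K (second_center ?K) \<or> second_center ?K = ?K"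
    using dich
  proof
    assume VV: "\<forall>v\<in>V. \<forall>w\<in>V. bracket v w \<in> Z"
    have "bracket x y \<in> Z" if xy: "x \<in> ?K" "y \<in> ?K" for x y
    proof -
      obtain c v c' v' where cv: "c \<in> C" "v \<in> V" "x = c + v" "c' \<in> C" "v' \<in> V" "y = c' + v'"
        using K_elim xy by meson
      have "bracket x y = bracket c y + (bracket v c' + bracket v v')"
        by (simp add: cv bracket_linear)
      also have "\<dots> \<in> Z"
        using cv VV bracket_second_center subspace_center by (auto intro!: subspace_add)
      finally show ?thesis .
    qed
    then have "second_center ?K = ?K"
      by (auto simp: second_center_def)
    then show ?thesis ..
  next
    assume rad: "\<forall>v\<in>V. (\<forall>w\<in>V. bracket v w \<in> Z) \<longrightarrow> v = 0"
    have sc: "second_center ?K = C"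
    proof
      show "C \<subseteq> second_center ?K"
        using C_K bracket_second_center by (auto simp: second_center_def[of ?K])
      show "second_center ?K \<subseteq> C"
      proof
        fix x assume "x \<in> second_center ?K"
        then have x: "x \<in> ?K" "\<And>y. y \<in> ?K \<Longrightarrow> bracket y x \<in> center ?K"
          using algK unfolding second_center_def[of ?K] center_def[of ?K] subalgebra_def by blast+
        obtain c v where cv: "c \<in> C" "v \<in> V" "x = c + v"
          using K_elim[OF x(1)] by blast
        have "bracket v w \<in> Z" if "w \<in> V" for w
        proof -
          have "bracket w c + bracket w v \<in> Z"
            using x(2)[of w] that V_K by (auto simp: centerK cv bracket_add_right)
          then show ?thesis
            using bracket_second_center(1)[OF cv(1), of w] bracket_in_center_commute[of v w]
            by (simp add: center_add_iff)
        qed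
        then have "v = 0"
          using rad cv by blast
        then show "x \<in> C"
          using cv by simp
      qed
    qed
    have "maximal_abelian ?K C"
      unfolding maximal_abelian_def
    proof (intro conjI allI impI)
      show "subalgebra C"
        using subspace_second_center bracket_in_second_center by (simp add: subalgebra_def)
      show "bracket_set C C = {0}"
        using second_center_abelian by (simp add: bracket_set_eq_zero_iff)
      fix B assume B: "subalgebra B \<and> B \<subseteq> ?K \<and> bracket_set B B = {0} \<and> C \<subseteq> B"
      \<comment> \<open>The \<open>V\<close> component of \<open>x\<close> commutes with
        \<open>C\<close>, hence lies in \<open>V\<close> \<inter> \<open>D\<close>.\<close>
      have "x \<in> C" if x: "x \<in> B" for x
      proof -
        obtain c v where cv: "c \<in> C" "v \<in> V" "x = c + v"
          using K_elim x B by blast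
        have "bracket y v = 0" if y: "y \<in> C" for y
        proof -
          have "bracket y x = 0"
            using B x y by (auto simp: bracket_set_eq_zero_iff)
          then show ?thesis
            using cv y second_center_abelian by (simp add: bracket_add_right)
        qed
        then have "v \<in> D"
          by (simp add: D_def)
        then have "v = 0"
          using cv VD by blast
        then show ?thesis
          using cv by simp
      qed
      then show "B = C"
        using B by blast
    qed (rule C_K)
    then show ?thesis
      by (simp add: sc)
  qed
  then have typeK: "type_A_plus ?K"
    using nilK by (simp add: type_A_plus_def)
  define A where "A = {x \<in> D. \<forall>v\<in>V. \<zeta> (bracket x v) = 0}"
  have subA: "subspace A"
    unfolding A_def
    by (rule subspaceI) (auto simp: subspace_D subspace_0 subspace_add subspace_scale form_linear)
  have Z_A: "Z \<subseteq> A"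
    using center_subset_second_center second_center_subset_D by (auto simp: A_def)
  have A_D: "A \<subseteq> D"
    by (auto simp: A_def)
  have A_V: "bracket x v \<in> X" if "x \<in> A" "v \<in> V" for x v
    using that bracket_in_second_center by (simp add: A_def X_def)
  have AA: "bracket x y \<in> Z" if "x \<in> A" "y \<in> A" for x y
    using that A_D bracket_D_D by blast
  have AA_Z: "bracket_set A A \<subseteq> Z"
    using AA by (intro bracket_set_subset subspace_center) auto
  have algA: "subalgebra A"
    using subA AA Z_A by (auto simp: subalgebra_def)
  have two_step: "two_step_nilpotent A"
    unfolding two_step_nilpotent_def bracket_set_eq_zero_iff using AA_Z by auto
  have A_K: "bracket_set A ?K \<subseteq> ?K"
    using algK C_K bracket_in_second_center
    by (intro bracket_set_subset) (auto simp: subalgebra_def)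
  have compat: "compatible A ?K (Z, X, V)"
    unfolding compatible_def prod.case
  proof (intro conjI)
    show "bracket_set A V \<subseteq> X"
      using A_V by (intro bracket_set_subset subspace_X) auto
    show "bracket_set A (Z + X) = {0}"
      unfolding center_plus_X bracket_set_eq_zero_iff using A_D bracket_D by auto
  qed (use algA algK A_K grading in auto)
  have "reduced_semidirect UNIV ?K A"
    unfolding reduced_semidirect_def
  proof (intro conjI)
    have "y \<in> ?K + A" for y
    proof -
      have "y \<in> V + D"
        using V_D by simp
      then obtain v d where vd: "v \<in> V" "d \<in> D" "y = v + d"
        by (rule set_plus_elim)
      \<comment> \<open>An element of \<open>D\<close> becomes one of \<open>A\<close> after
        subtracting the \<open>x\<close> in \<open>X\<close> that acts on \<open>V\<close> through
        the same functional; \<open>x\<close> itself is absorbed by \<open>?K\<close>.\<close>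
      obtain x where x: "x \<in> X" "\<And>w. w \<in> V \<Longrightarrow> \<zeta> (bracket x w) = \<zeta> (bracket d w)"
        by (rule represent_functional[OF subspace_X V ndV, of "\<lambda>w. \<zeta> (bracket d w)"])
          (auto simp: form_linear)
      have "x \<in> D"
        using x X_C second_center_subset_D by blast
      then have "d - x \<in> A"
        using vd x subspace_D by (simp add: A_def subspace_diff form_diff)
      moreover have "x + v \<in> ?K"
        unfolding K_eq using x vd X_C by (intro set_plus_intro) auto
      ultimately have "(x + v) + (d - x) \<in> ?K + A"
        by (rule set_plus_intro[rotated])
      then show ?thesis
        using vd by simp
    qed
    then show "UNIV = ?K + A"
      by auto
    show "Z = ?K \<inter> A"
    proof
      show "Z \<subseteq> ?K \<inter> A"
        using Z_A C_K center_subset_second_center by blast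
      show "?K \<inter> A \<subseteq> Z"
      proof
        fix x assume x: "x \<in> ?K \<inter> A"
        then obtain c v where cv: "c \<in> C" "v \<in> V" "x = c + v"
          using K_elim by blast
        \<comment> \<open>Membership in \<open>D\<close> removes the \<open>V\<close> component.
          What remains lies in \<open>C\<close> and is orthogonal to \<open>V\<close> by the
          definition of \<open>A\<close>, hence central.\<close>
        have "x - c \<in> D"
          using x A_D cv second_center_subset_D subspace_D by (intro subspace_diff) auto
        then have "v = 0"
          using cv VD by auto
        then have xc: "x \<in> C"
          using cv by simp
        have "bracket w x = 0" if "w \<in> V" for w
        proof (rule center_coord_zero)
          show "bracket w x \<in> Z"
            using xc bracket_second_center by blast
          show "\<zeta> (bracket w x) = 0"
            using x that by (simp add: A_def form_skew[of w x])
        qed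
        then show "x \<in> Z"
          using commute_Z xc by blast
      qed
    qed
  qed (use algK algA A_K dim_center in \<open>auto simp: subalgebra_def\<close>)
  then show ?thesis
    using typeK two_step AA_Z grading compat by blast
qed

end

context lie_algebra_dim1_center
begin

text \<open>With \<open>K1 = Z\<close> and \<open>A = UNIV\<close>, the grading (Z, {0}, {0}) pairs
  two zero spaces, and \<open>Z\<close> is its own second center.\<close>

lemma decomposition_of_two_step:
  assumes nil: "nilpotent UNIV" and C: "C = UNIV"
  shows "\<exists>K1 A. reduced_semidirect UNIV K1 A \<and> type_A_plus K1 \<and> two_step_nilpotent A \<and>
    bracket_set A A \<subseteq> Z \<and> (\<exists>\<gamma>. grading_A_plus K1 \<gamma> \<and> compatible A K1 \<gamma>)"
proof -
  have bZ: "bracket x y \<in> Z" for x y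
    using bracket_second_center[of y x] C by simp
  have sub: "bracket_set A B \<subseteq> Z" for A B
    using bZ by (intro bracket_set_subset subspace_center)
  have algZ: "subalgebra Z"
    using bZ subspace_center unfolding subalgebra_def by blast
  have cZ: "center Z = Z"
    by (auto simp: center_def[of Z])
  have nilZ: "nilpotent_dim1_center Z"
    using algZ nilpotent_subspace[OF nil] subspace_center dim_center
    by (simp add: nilpotent_dim1_center_def cZ)
  have "second_center Z = Z"
    by (auto simp: second_center_def)
  then have typeZ: "type_A_plus Z"
    using nilZ by (simp add: type_A_plus_def)
  have zero_Z: "0 \<in> Z"
    by (rule subspace_0[OF subspace_center])
  have Z0: "Z + {0} = Z"
    by (auto simp: set_plus_def)
  have zero: "bracket_set A {0} = {0}" "bracket_set {0} A = {0}" for A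
    by (simp_all add: bracket_set_eq_zero_iff)
  have gr: "grading_A_plus Z (Z, {0}, {0})"
    using nilZ subspace_center zero_Z
    by (simp add: grading_A_plus_def direct_sum3_def zero cZ Z0)
  have "bracket_set UNIV Z = {0}"
    by (simp add: bracket_set_eq_zero_iff)
  then have "compatible UNIV Z (Z, {0}, {0})"
    using algZ gr sub zero_Z by (simp add: compatible_def zero Z0 subalgebra_def)
  moreover have "reduced_semidirect UNIV Z UNIV"
    using algZ sub dim_center set_plus_intro[OF zero_Z, of _ UNIV]
    by (auto simp: reduced_semidirect_def subalgebra_def)
  moreover have "two_step_nilpotent UNIV"
    unfolding two_step_nilpotent_def bracket_set_eq_zero_iff
    using sub[of UNIV UNIV] bracket_center(2) by blast
  ultimately show ?thesis
    using typeZ gr sub by blast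
qed

lemma decomposition_of_three_step:
  assumes two: "(2::'k) \<noteq> 0" and three: "three_step_nilpotent UNIV" and A: "type_A UNIV"
  shows "\<exists>K1 A. reduced_semidirect UNIV K1 A \<and> type_A_plus K1 \<and> two_step_nilpotent A \<and>
    bracket_set A A \<subseteq> Z \<and> (\<exists>\<gamma>. grading_A_plus K1 \<gamma> \<and> compatible A K1 \<gamma>)"
proof (cases "C = UNIV")
  case True
  then show ?thesis
    using decomposition_of_two_step A by (simp add: type_A_def nilpotent_dim1_center_def)
next
  case False
  \<comment> \<open>Type (A) now leaves the alternative that \<open>C\<close> is abelian, and
    three-step nilpotency places every bracket in \<open>C\<close>.\<close>
  interpret three_step_lie_algebra scale Basis bracket e \<zeta>
  proof
    show "bracket x y = 0" if "x \<in> C" "y \<in> C" for x y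
      using A False that by (simp add: type_A_def bracket_set_eq_zero_iff)
    show "bracket x y \<in> C" for x y
      using three
      by (auto simp: three_step_nilpotent_def bracket_set_eq_zero_iff second_center_def
          intro!: bracket_in_bracket_set)
  qed
  show ?thesis
    using reduced_semidirect_decomposition two A by (simp add: type_A_def nilpotent_dim1_center_def)
qed

end

context lie_algebra
begin

lemma ex_center_coordinate:
  assumes "dim (center UNIV) = 1"
  obtains e \<zeta> where "lie_algebra_dim1_center scale Basis bracket e \<zeta>"
proof -
  obtain B where B: "B \<subseteq> center UNIV" "independent B" "center UNIV \<subseteq> span B" "card B = 1"
    using basis_exists[of "center UNIV"] assms by metis
  then obtain e where e: "B = {e}"
    by (auto simp: card_1_singleton_iff)
  have "e \<noteq> 0"
    using B e dependent_zero by blast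
  obtain \<zeta> where "\<And>x y. \<zeta> (x + y) = \<zeta> x + \<zeta> y" "\<And>a x. \<zeta> (scale a x) = a * \<zeta> x" "\<zeta> e = 1"
    by (rule ex_dual_functional[OF \<open>e \<noteq> 0\<close>], rule that)
  moreover have "center UNIV = range (\<lambda>a. scale a e)"
    using B e by (auto simp: span_singleton center_def bracket_scale_right)
  ultimately show thesis
    by (intro that) unfold_locales
qed

end

theorem theorem5p1:
  fixes scale :: "'k::field \<Rightarrow> 'v::ab_group_add \<Rightarrow> 'v"
    and Basis :: "'v set"
    and bracket :: "'v \<Rightarrow> 'v \<Rightarrow> 'v"
  assumes "lie_algebra scale Basis bracket"
    and "CHAR('k) \<noteq> 2"
  shows
    "(lie_algebra.nilpotent scale bracket UNIV \<and>
      vector_space.dim scale (lie_algebra.center bracket UNIV) = 1 \<longrightarrow>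
        (\<exists>H A. lie_algebra.reduced_direct scale bracket UNIV H A \<and>
               lie_algebra.heisenberg scale bracket H \<and>
               lie_algebra.type_A scale bracket A)) \<and>
     (lie_algebra.three_step_nilpotent scale bracket UNIV \<and>
      lie_algebra.type_A scale bracket UNIV \<longrightarrow>
        (\<exists>K1 A. lie_algebra.reduced_semidirect scale bracket UNIV K1 A \<and>
                lie_algebra.type_A_plus scale bracket K1 \<and>
                lie_algebra.two_step_nilpotent scale bracket A \<and>
                lie_algebra.bracket_set scale bracket A A \<subseteq> lie_algebra.center bracket UNIV \<and>
                (\<exists>\<gamma>. lie_algebra.grading_A_plus scale bracket K1 \<gamma> \<and>
                     lie_algebra.compatible scale bracket A K1 \<gamma>)))"
proof -
  interpret lie_algebra scale Basis bracket
    by (rule assms(1))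
  have two: "(2::'k) \<noteq> 0"
  proof
    assume "(2::'k) = 0"
    then have "of_nat 2 = (0::'k)"
      by simp
    then have "CHAR('k) dvd 2"
      by (simp only: of_nat_eq_0_iff_char_dvd)
    then have "CHAR('k) \<le> 2" "CHAR('k) \<noteq> 0"
      by (auto dest: dvd_imp_le dvd_pos_nat[rotated])
    then have "CHAR('k) = 1"
      using assms(2) by linarith
    then show False
      using of_nat_CHAR[where 'a = 'k] by simp
  qed
  show ?thesis
  proof (intro conjI impI; elim conjE)
    assume nil: "nilpotent UNIV" and dim1: "dim (center UNIV) = 1"
    obtain e \<zeta> where "lie_algebra_dim1_center scale Basis bracket e \<zeta>"
      using dim1 by (rule ex_center_coordinate)
    then show "\<exists>H A. reduced_direct UNIV H A \<and> heisenberg H \<and> type_A A"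
      using two nil by (rule lie_algebra_dim1_center.heisenberg_decomposition)
  next
    assume three: "three_step_nilpotent UNIV" and A: "type_A UNIV"
    then have "dim (center UNIV) = 1"
      by (simp add: type_A_def nilpotent_dim1_center_def)
    then obtain e \<zeta> where "lie_algebra_dim1_center scale Basis bracket e \<zeta>"
      by (rule ex_center_coordinate)
    then show "\<exists>K1 A. reduced_semidirect UNIV K1 A \<and> type_A_plus K1 \<and> two_step_nilpotent A \<and>
        bracket_set A A \<subseteq> center UNIV \<and> (\<exists>\<gamma>. grading_A_plus K1 \<gamma> \<and> compatible A K1 \<gamma>)"
      using two three A by (rule lie_algebra_dim1_center.decomposition_of_three_step)
  qed
qed

end
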